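(* For $n\geq 2$, the group $\mathrm{Spe}(W_n)$ does not have Serre's property $\mathrm{F}\mathcal{A}$. Consequently neither $\mathrm{Spe}(W_n)$ nor $\mathrm{Aut}(W_n)$ has Kazhdan's property (T).
   Context: $W_n=\langle s_1,\dots,s_n\mid s_1^2,\dots,s_n^2\rangle$ is the universal Coxeter group of rank $n$. The group $\mathrm{Aut}(W_n)$ acts on the set of conjugacy classes of involutions of $W_n$; the kernel of this action is the group of special automorphisms $\mathrm{Spe}(W_n)$ (it is a finite index normal subgroup with $\mathrm{Aut}(W_n)/\mathrm{Spe}(W_n)\cong\mathrm{Sym}(n)$). A group has Serre's property $\mathrm{F}\mathcal{A}$ if every simplicial action without inversions on a simplicial tree has a global fixed point. *)

theory Defs
  imports "HOL-Analysis.Analysis" "HOL-Algebra.Bij"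
begin

section \<open>The universal Coxeter group W_n (reduced-word model)\<close>

text \<open>Elements of W_n are reduced words in the generators s_0,...,s_(n-1), i.e.
  lists over {..<n} without two equal adjacent letters. Multiplication is
  concatenation followed by free cancellation of s_i s_i.\<close>

fun cancel :: "nat list \<Rightarrow> nat list \<Rightarrow> nat list" where
  "cancel [] ys = ys"
| "cancel (x # xs) [] = rev (x # xs)"
| "cancel (x # xs) (y # ys) = (if x = y then cancel xs ys else rev (x # xs) @ y # ys)"

definition wmult :: "nat list \<Rightarrow> nat list \<Rightarrow> nat list" where
  "wmult xs ys = cancel (rev xs) ys"

definition reduced_word :: "nat \<Rightarrow> nat list \<Rightarrow> bool" where
  "reduced_word n xs \<longleftrightarrow> set xs \<subseteq> {..<n} \<and> (\<forall>i. Suc i < length xs \<longrightarrow> xs ! i \<noteq> xs ! Suc i)"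

definition W :: "nat \<Rightarrow> nat list monoid" where
  "W n = \<lparr>carrier = {xs. reduced_word n xs}, mult = wmult, one = []\<rparr>"

section \<open>Aut(W_n) and the special automorphisms Spe(W_n)\<close>

definition Aut_group :: "nat \<Rightarrow> (nat list \<Rightarrow> nat list) monoid" where
  "Aut_group n = AutoGroup (W n)"

definition involutions :: "('a, 'b) monoid_scheme \<Rightarrow> 'a set" where
  "involutions G = {x \<in> carrier G. x \<noteq> \<one>\<^bsub>G\<^esub> \<and> x \<otimes>\<^bsub>G\<^esub> x = \<one>\<^bsub>G\<^esub>}"

definition conj_class :: "('a, 'b) monoid_scheme \<Rightarrow> 'a \<Rightarrow> 'a set" where
  "conj_class G x = {g \<otimes>\<^bsub>G\<^esub> x \<otimes>\<^bsub>G\<^esub> inv\<^bsub>G\<^esub> g | g. g \<in> carrier G}"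

text \<open>Spe(W_n): kernel of the action of Aut(W_n) on conjugacy classes of involutions.\<close>
definition Spe_set :: "nat \<Rightarrow> (nat list \<Rightarrow> nat list) set" where
  "Spe_set n = {\<phi> \<in> carrier (Aut_group n).
      \<forall>x \<in> involutions (W n). conj_class (W n) (\<phi> x) = conj_class (W n) x}"

definition Spe_group :: "nat \<Rightarrow> (nat list \<Rightarrow> nat list) monoid" where
  "Spe_group n = (Aut_group n)\<lparr>carrier := Spe_set n\<rparr>"

section \<open>Simplicial trees and Serre's property FA\<close>

text \<open>A simplicial graph is given by a vertex set V (a subset of a type 'v) and a
  symmetric irreflexive adjacency relation E on V.\<close>

definition is_walk :: "('v \<times> 'v) set \<Rightarrow> 'v list \<Rightarrow> bool" where
  "is_walk E xs \<longleftrightarrow> xs \<noteq> [] \<and> (\<forall>i. Suc i < length xs \<longrightarrow> (xs ! i, xs ! Suc i) \<in> E)"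

definition no_backtracking :: "'v list \<Rightarrow> bool" where
  "no_backtracking xs \<longleftrightarrow> (\<forall>i. Suc (Suc i) < length xs \<longrightarrow> xs ! i \<noteq> xs ! Suc (Suc i))"

definition simplicial_tree :: "'v set \<Rightarrow> ('v \<times> 'v) set \<Rightarrow> bool" where
  "simplicial_tree V E \<longleftrightarrow>
     V \<noteq> {} \<and> E \<subseteq> V \<times> V \<and> sym E \<and> (\<forall>v. (v, v) \<notin> E) \<and>
     (\<forall>u \<in> V. \<forall>v \<in> V. (u, v) \<in> E\<^sup>*) \<and>
     (\<forall>xs. is_walk E xs \<and> no_backtracking xs \<and> length xs \<ge> 2 \<longrightarrow> hd xs \<noteq> last xs)"

text \<open>A simplicial action of G on the tree (V,E): a homomorphism from G to the
  automorphism group of the graph.\<close>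
definition tree_action :: "('g, 'b) monoid_scheme \<Rightarrow> 'v set \<Rightarrow> ('v \<times> 'v) set \<Rightarrow> ('g \<Rightarrow> 'v \<Rightarrow> 'v) \<Rightarrow> bool" where
  "tree_action G V E act \<longleftrightarrow>
     (\<forall>g \<in> carrier G. bij_betw (act g) V V \<and>
        (\<forall>u \<in> V. \<forall>v \<in> V. (act g u, act g v) \<in> E \<longleftrightarrow> (u, v) \<in> E)) \<and>
     (\<forall>v \<in> V. act \<one>\<^bsub>G\<^esub> v = v) \<and>
     (\<forall>g \<in> carrier G. \<forall>h \<in> carrier G. \<forall>v \<in> V. act (g \<otimes>\<^bsub>G\<^esub> h) v = act g (act h v))"

definition without_inversions :: "('g, 'b) monoid_scheme \<Rightarrow> ('v \<times> 'v) set \<Rightarrow> ('g \<Rightarrow> 'v \<Rightarrow> 'v) \<Rightarrow> bool" where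
  "without_inversions G E act \<longleftrightarrow>
     \<not> (\<exists>g \<in> carrier G. \<exists>(u, v) \<in> E. act g u = v \<and> act g v = u)"

text \<open>Property FA, relative to trees whose vertices lie in the type 'v.\<close>
definition has_FA :: "'v itself \<Rightarrow> ('g, 'b) monoid_scheme \<Rightarrow> bool" where
  "has_FA _ G \<longleftrightarrow>
     (\<forall>(V :: 'v set) E act. simplicial_tree V E \<and> tree_action G V E act \<and>
        without_inversions G E act \<longrightarrow> (\<exists>v \<in> V. \<forall>g \<in> carrier G. act g v = v))"

section \<open>Kazhdan's property (T)\<close>

text \<open>Orthogonal (real unitary) representation of a discrete group G on a closed
  subspace H of the real Hilbert space 'h.\<close>
definition orth_rep :: "('g, 'b) monoid_scheme \<Rightarrow> ('h::real_inner) set \<Rightarrow> ('g \<Rightarrow> 'h \<Rightarrow> 'h) \<Rightarrow> bool" where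
  "orth_rep G H U \<longleftrightarrow>
     (\<forall>g \<in> carrier G. U g ` H = H \<and>
        (\<forall>x \<in> H. \<forall>y \<in> H. U g (x + y) = U g x + U g y) \<and>
        (\<forall>x \<in> H. \<forall>a. U g (a *\<^sub>R x) = a *\<^sub>R U g x) \<and>
        (\<forall>x \<in> H. norm (U g x) = norm x)) \<and>
     (\<forall>x \<in> H. U \<one>\<^bsub>G\<^esub> x = x) \<and>
     (\<forall>g \<in> carrier G. \<forall>h \<in> carrier G. \<forall>x \<in> H. U (g \<otimes>\<^bsub>G\<^esub> h) x = U g (U h x))"

definition almost_invariant_vectors :: "('g, 'b) monoid_scheme \<Rightarrow> ('h::real_inner) set \<Rightarrow> ('g \<Rightarrow> 'h \<Rightarrow> 'h) \<Rightarrow> bool" where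
  "almost_invariant_vectors G H U \<longleftrightarrow>
     (\<forall>Q \<subseteq> carrier G. finite Q \<longrightarrow> (\<forall>\<epsilon>>0. \<exists>\<xi> \<in> H. norm \<xi> = 1 \<and>
        (\<forall>g \<in> Q. norm (U g \<xi> - \<xi>) < \<epsilon>)))"

text \<open>Property (T), relative to (closed subspaces of) the Hilbert space type 'h.\<close>
definition has_T :: "('h::{real_inner, complete_space}) itself \<Rightarrow> ('g, 'b) monoid_scheme \<Rightarrow> bool" where
  "has_T _ G \<longleftrightarrow>
     (\<forall>(H :: 'h set) U. subspace H \<and> closed H \<and> orth_rep G H U \<and>
        almost_invariant_vectors G H U \<longrightarrow>
        (\<exists>\<xi> \<in> H. \<xi> \<noteq> 0 \<and> (\<forall>g \<in> carrier G. U g \<xi> = \<xi>)))"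

end

theory Submission
  imports Defs
begin

text \<open>
  For an ordered pair of distinct letters \<open>i\<close>, \<open>j\<close>, killing all other letters maps \<open>W_n\<close> onto the
  infinite dihedral group, which acts on the simplicial line, with \<open>s_i\<close> and \<open>s_j\<close> reflecting in
  0 and 1. Involutions of \<open>W_n\<close> are palindromes of odd length, hence conjugate to generators, so an
  automorphism permutes the conjugacy classes of the generators and carries the line of \<open>(i, j)\<close> to
  that of the permuted pair by an isometry: a vertex of a line is the reflection that fixes it.
  Thus \<open>Aut(W_n)\<close> acts on the union of these finitely many lines.

  \<open>Spe(W_n)\<close> preserves the line of \<open>(0, 1)\<close> and the parity of its vertices, so it inverts no edge;
  conjugation by \<open>s_0\<close> fixes only the vertex 0, and conjugation by \<open>s_1\<close> only 1, so there is no
  global fixed vertex. Long intervals are almost invariant under isometries of a line, so the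
  permutation representation on the square-summable functions on the union of the lines has
  almost invariant vectors, while the inner automorphisms, which lie in \<open>Spe(W_n)\<close>, translate
  along each line and leave no nonzero such function invariant.
\<close>

section \<open>Words and conjugates of generators\<close>

lemma reduced_word_iff: "reduced_word n xs \<longleftrightarrow> set xs \<subseteq> {..<n} \<and> distinct_adj xs"
  by (simp add: reduced_word_def distinct_adj_conv_nth)

lemma reduced_word_set: "reduced_word n xs \<Longrightarrow> set xs \<subseteq> {..<n}"
  by (simp add: reduced_word_iff)

lemma reduced_word_Nil [simp]: "reduced_word n []"
  by (simp add: reduced_word_iff)

lemma reduced_word_single [simp]: "reduced_word n [k] \<longleftrightarrow> k < n"
  by (simp add: reduced_word_iff)

lemma reduced_word_rev [simp]: "reduced_word n (rev xs) \<longleftrightarrow> reduced_word n xs"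
  by (simp add: reduced_word_iff)

lemma reduced_word_Cons:
  "reduced_word n (x # xs) \<longleftrightarrow> x < n \<and> reduced_word n xs \<and> (xs = [] \<or> x \<noteq> hd xs)"
  by (auto simp: reduced_word_iff distinct_adj_Cons)

text \<open>Left multiplication by a letter. Words act by folding it, so that associativity of
  \<open>wmult\<close> comes down to \<open>push a\<close> being an involution on reduced words.\<close>
fun push :: "nat \<Rightarrow> nat list \<Rightarrow> nat list" where
  "push a [] = [a]"
| "push a (y # ys) = (if a = y then ys else a # y # ys)"

lemma push_reduced: "reduced_word n xs \<Longrightarrow> a < n \<Longrightarrow> reduced_word n (push a xs)"
  by (cases xs) (auto simp: reduced_word_Cons)

lemma push_Cons: "reduced_word n (x # xs) \<Longrightarrow> push x xs = x # xs"
  by (cases xs) (auto simp: reduced_word_Cons)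

lemma push_push:
  assumes "reduced_word n xs"
  shows "push a (push a xs) = xs"
proof (cases xs)
  case (Cons y ys)
  with assms show ?thesis by (cases "a = y") (auto simp: push_Cons)
qed simp

text \<open>No cancellation can occur when the concatenation is itself reduced, so every push just
  prepends.\<close>

lemma foldr_push_append: "reduced_word n (xs @ ys) \<Longrightarrow> foldr push xs ys = xs @ ys"
proof (induction xs)
  case (Cons x xs)
  then have "reduced_word n (xs @ ys)" by (simp add: reduced_word_Cons)
  then have "foldr push (x # xs) ys = push x (xs @ ys)" using Cons.IH by simp
  also have "\<dots> = (x # xs) @ ys" using push_Cons[of n x "xs @ ys"] Cons.prems by simp
  finally show ?case .
qed simp

lemma foldr_push_Nil: "reduced_word n xs \<Longrightarrow> foldr push xs [] = xs"
  using foldr_push_append[of n xs "[]"] by simp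

text \<open>The first argument of \<open>cancel\<close> is the left factor reversed, so its head is
  the letter next to the junction, which \<open>fold\<close> pushes first. Once the two junction
  letters differ, the word across the junction is reduced and nothing more cancels.\<close>

lemma cancel_conv_fold:
  "reduced_word n xs \<Longrightarrow> reduced_word n ys \<Longrightarrow> cancel xs ys = fold push xs ys"
proof (induction xs ys rule: cancel.induct)
  case (2 x xs)
  have "foldr push (rev (x # xs)) [] = rev (x # xs)"
    by (rule foldr_push_Nil[of n]) (simp only: reduced_word_rev 2)
  then show ?case by (simp only: foldr_conv_fold rev_rev_ident cancel.simps)
next
  case (3 x xs y ys)
  show ?case
  proof (cases "x = y")
    case True
    then show ?thesis using 3 by (auto simp: reduced_word_Cons)
  next
    case False
    then have "reduced_word n (rev (x # xs) @ y # ys)"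
      using 3(2,3) unfolding reduced_word_iff distinct_adj_append_iff
      by (simp add: last_rev del: rev.simps)
    then have "foldr push (rev (x # xs)) (y # ys) = rev (x # xs) @ y # ys"
      by (rule foldr_push_append)
    then show ?thesis using False by (simp only: foldr_conv_fold rev_rev_ident cancel.simps if_False)
  qed
qed simp

section \<open>The group law on reduced words\<close>

lemma wmult_conv_foldr:
  "reduced_word n xs \<Longrightarrow> reduced_word n ys \<Longrightarrow> wmult xs ys = foldr push xs ys"
  unfolding wmult_def by (subst cancel_conv_fold[of n]) (auto simp: foldr_conv_fold)

lemma foldr_push_reduced:
  "set xs \<subseteq> {..<n} \<Longrightarrow> reduced_word n ys \<Longrightarrow> reduced_word n (foldr push xs ys)"
  by (induction xs) (auto intro: push_reduced)

lemma wmult_reduced: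
  "reduced_word n xs \<Longrightarrow> reduced_word n ys \<Longrightarrow> reduced_word n (wmult xs ys)"
  by (simp add: wmult_conv_foldr foldr_push_reduced reduced_word_set)

text \<open>The case with content is \<open>a\<close> cancelling against the head of
  \<open>us\<close>: then the right-hand side pushes \<open>a\<close> twice, which changes
  nothing.\<close>

lemma foldr_push_push:
  assumes "reduced_word n us" "reduced_word n zs"
  shows "foldr push (push a us) zs = push a (foldr push us zs)"
proof (cases us)
  case (Cons y ys)
  have "reduced_word n (foldr push ys zs)"
    using assms Cons by (intro foldr_push_reduced) (auto simp: reduced_word_iff)
  with Cons show ?thesis by (auto simp: push_push)
qed simp

lemma foldr_push_assoc:
  assumes "set xs \<subseteq> {..<n}" "reduced_word n ys" "reduced_word n zs"
  shows "foldr push (foldr push xs ys) zs = foldr push xs (foldr push ys zs)"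
  using assms(1) by (induction xs) (auto simp: foldr_push_push[OF foldr_push_reduced] assms)

lemma wmult_assoc:
  assumes "reduced_word n xs" "reduced_word n ys" "reduced_word n zs"
  shows "wmult (wmult xs ys) zs = wmult xs (wmult ys zs)"
  using assms
  by (simp add: wmult_conv_foldr[of n] foldr_push_reduced foldr_push_assoc[of _ n] reduced_word_set)

lemma wmult_Nil [simp]: "wmult [] xs = xs"
  by (simp add: wmult_def)

lemma wmult_Nil_right [simp]: "wmult xs [] = xs"
  unfolding wmult_def by (cases "rev xs") auto

lemma cancel_self: "cancel xs xs = []"
  by (induction xs) auto

lemma wmult_rev_left: "wmult (rev xs) xs = []"
  by (simp add: wmult_def cancel_self)

lemma wmult_rev_right: "wmult xs (rev xs) = []"
  using wmult_rev_left[of "rev xs"] by simp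

lemma carrier_W [simp]: "carrier (W n) = {xs. reduced_word n xs}"
  and mult_W [simp]: "mult (W n) = wmult"
  and one_W [simp]: "one (W n) = []"
  by (simp_all add: W_def)

lemma group_W: "group (W n)"
proof (rule groupI)
  fix x assume "x \<in> carrier (W n)"
  then show "\<exists>y\<in>carrier (W n). y \<otimes>\<^bsub>W n\<^esub> x = \<one>\<^bsub>W n\<^esub>"
    by (intro bexI[of _ "rev x"]) (auto simp: wmult_rev_left)
qed (auto simp: wmult_reduced wmult_assoc)

lemma inv_W: "reduced_word n x \<Longrightarrow> inv\<^bsub>W n\<^esub> x = rev x"
  by (rule group.inv_equality[OF group_W]) (auto simp: wmult_rev_left)

lemma rev_wmult:
  assumes "reduced_word n u" "reduced_word n v"
  shows "rev (wmult u v) = wmult (rev v) (rev u)"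
  using group.inv_mult_group[OF group_W, of u n v] assms by (simp add: inv_W wmult_reduced)

text \<open>Extension of maps from letters to words. When every letter acts by an involution this is
  the universal property of W_n as a free product of groups of order 2; both the parity characters
  and the dihedral actions arise this way.\<close>

definition letters_act :: "(nat \<Rightarrow> 'a \<Rightarrow> 'a) \<Rightarrow> nat list \<Rightarrow> 'a \<Rightarrow> 'a" where
  "letters_act r w = foldr (\<lambda>k g. r k \<circ> g) w id"

lemma letters_act_Nil [simp]: "letters_act r [] = id"
  and letters_act_Cons [simp]: "letters_act r (k # w) = r k \<circ> letters_act r w"
  by (simp_all add: letters_act_def)

lemma letters_act_push:
  assumes "\<And>k. r k \<circ> r k = id"
  shows "letters_act r (push a w) = r a \<circ> letters_act r w"
  by (cases w) (auto simp: assms simp flip: comp_assoc)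

lemma letters_act_wmult:
  assumes "\<And>k. r k \<circ> r k = id" "reduced_word n v" "reduced_word n w"
  shows "letters_act r (wmult v w) = letters_act r v \<circ> letters_act r w"
proof -
  have "letters_act r (foldr push v w) = letters_act r v \<circ> letters_act r w"
    by (induction v) (auto simp: letters_act_push assms(1))
  then show ?thesis using assms by (simp add: wmult_conv_foldr)
qed

lemma letters_act_rev:
  assumes "\<And>k. r k \<circ> r k = id" "reduced_word n w"
  shows "letters_act r w (letters_act r (rev w) x) = x"
  using letters_act_wmult[OF assms(1,2), of "rev w"] assms(2)
  by (auto simp: wmult_rev_right fun_eq_iff)

section \<open>Conjugacy classes of generators and of involutions\<close>

definition is_conj :: "nat \<Rightarrow> nat \<Rightarrow> nat list \<Rightarrow> bool" where
  "is_conj n k w \<longleftrightarrow> (\<exists>u. reduced_word n u \<and> w = wmult (wmult u [k]) (rev u))"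

lemma letters_act_conj:
  assumes r: "\<And>k. r k \<circ> r k = id" and u: "reduced_word n u" "k < n"
  shows "letters_act r (wmult (wmult u [k]) (rev u)) =
    letters_act r u \<circ> r k \<circ> letters_act r (rev u)"
  by (subst letters_act_wmult[OF r, of n], use u in \<open>auto intro: wmult_reduced\<close>)+

text \<open>The number of letters \<open>k\<close> modulo 2 is a homomorphism to the group of order
  2, and it separates the class of \<open>k\<close> from the class of any other generator.\<close>

lemma is_conj_unique:
  assumes "is_conj n k w" "is_conj n l w" "k < n" "l < n"
  shows "k = l"
proof (rule ccontr)
  assume kl: "k \<noteq> l"
  \<comment> \<open>The group of order 2 is realised on \<open>bool\<close> by \<open>id\<close> and
    \<open>Not\<close>. It is commutative, so conjugation does not affect the image.\<close>
  define r :: "nat \<Rightarrow> bool \<Rightarrow> bool" where "r = (\<lambda>m. if m = k then Not else id)"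
  have r: "r m \<circ> r m = id" for m by (auto simp: r_def)
  have parity: "letters_act r v = id \<or> letters_act r v = Not" for v
    by (induction v) (auto simp: r_def)
  have comm: "letters_act r v \<circ> r m = r m \<circ> letters_act r v" for v m
    using parity[of v] by (auto simp: r_def)
  have "letters_act r w = r m" if m: "is_conj n m w" "m < n" for m
  proof -
    from m obtain u where u: "reduced_word n u" "w = wmult (wmult u [m]) (rev u)"
      by (auto simp: is_conj_def)
    show ?thesis
      using letters_act_rev[OF r u(1)] unfolding u(2) letters_act_conj[OF r u(1) m(2)] comm
      by (auto simp: fun_eq_iff)
  qed
  from this[of k] this[of l] assms have "r k = r l" by simp
  then show False using kl by (auto simp: r_def fun_eq_iff)
qed

lemma is_conj_self: "k < n \<Longrightarrow> is_conj n k [k]"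
  unfolding is_conj_def by (intro exI[of _ "[]"]) simp

lemma is_conj_conj:
  assumes "reduced_word n u" "is_conj n k w" "k < n"
  shows "is_conj n k (wmult (wmult u w) (rev u))"
proof -
  obtain v where v: "reduced_word n v" "w = wmult (wmult v [k]) (rev v)"
    using assms by (auto simp: is_conj_def)
  have "wmult (wmult u w) (rev u) = wmult (wmult (wmult u v) [k]) (rev (wmult u v))"
    using assms v by (simp add: wmult_assoc[of n] wmult_reduced rev_wmult[of n])
  then show ?thesis
    using wmult_reduced[OF assms(1) v(1)] unfolding is_conj_def by blast
qed

text \<open>The inverse of a reduced word is its reversal, so an involution is a palindrome of odd
  length.\<close>
lemma palindrome_is_conj:
  "reduced_word n w \<Longrightarrow> rev w = w \<Longrightarrow> w \<noteq> [] \<Longrightarrow> \<exists>k<n. is_conj n k w"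
proof (induction w rule: length_induct)
  case (1 w)
  show ?case
  proof (cases "\<exists>a. w = [a]")
    case True
    then show ?thesis using 1 is_conj_self by auto
  next
    case False
    obtain a w' where aw: "w = a # w'" using \<open>w \<noteq> []\<close> by (cases w) auto
    then have "w' \<noteq> []" using False by auto
    then obtain v c where "w' = v @ [c]" by (cases w' rule: rev_cases) auto
    with aw have w: "w = a # v @ [c]" by simp
    have "rev (a # v @ [c]) = a # v @ [c]" using 1(3) unfolding w .
    then have "c # rev v @ [a] = a # v @ [c]" unfolding rev.simps rev_append append.simps append_assoc .
    then have "c = a \<and> rev v @ [a] = v @ [c]" unfolding list.inject .
    then have ca: "c = a" "rev v = v" unfolding append1_eq_conv by blast+
    have red: "reduced_word n (a # v @ [a])" using 1(2) unfolding w ca .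
    then have "reduced_word n ([a] @ v @ [a])" by simp
    then have v: "reduced_word n v" "a < n"
      unfolding reduced_word_iff distinct_adj_append_iff by simp_all
    \<comment> \<open>An empty middle would give the word \<open>[a, a]\<close>, which is not
      reduced; this excludes even length.\<close>
    have "v \<noteq> []" using red by (auto simp: reduced_word_Cons)
    moreover have "length v < length w" by (simp add: w)
    ultimately obtain k where k: "k < n" "is_conj n k v" using 1(1) v(1) ca(2) by blast
    have "w = wmult (wmult [a] v) [a]"
    proof -
      have "wmult [a] v = a # v" using red \<open>v \<noteq> []\<close>
        by (cases v) (auto simp: wmult_def reduced_word_Cons)
      moreover have "reduced_word n (a # v)"
        using red by (auto simp: reduced_word_iff distinct_adj_append_iff simp flip: append_Cons)
      then have "wmult (a # v) [a] = (a # v) @ [a]"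
        using red foldr_push_append[of n "a # v" "[a]"] v(2) by (simp add: wmult_conv_foldr[of n])
      ultimately show ?thesis by (simp add: w ca)
    qed
    then have "w = wmult (wmult [a] v) (rev [a])" by simp
    then show ?thesis using k v(2) is_conj_conj[of n "[a]" k v] by auto
  qed
qed

lemma involution_is_conj:
  assumes "w \<in> involutions (W n)"
  shows "\<exists>k<n. is_conj n k w"
proof (rule palindrome_is_conj)
  show w: "reduced_word n w" "w \<noteq> []" using assms by (auto simp: involutions_def)
  have "inv\<^bsub>W n\<^esub> w = w"
    using assms by (intro group.inv_equality[OF group_W]) (auto simp: involutions_def)
  then show "rev w = w" using w by (simp add: inv_W)
qed

lemma single_involution: "k < n \<Longrightarrow> [k] \<in> involutions (W n)"
  using wmult_rev_left[of "[k]"] by (simp add: involutions_def)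

section \<open>Automorphisms of the universal Coxeter group\<close>

lemma carrier_Aut [simp]: "carrier (Aut_group n) = auto (W n)"
  and one_Aut: "\<one>\<^bsub>Aut_group n\<^esub> = (\<lambda>w\<in>{w. reduced_word n w}. w)"
  by (simp_all add: Aut_group_def AutoGroup_def BijGroup_def)

lemma Aut_mult_apply:
  assumes "\<phi> \<in> auto (W n)" "\<psi> \<in> auto (W n)" "reduced_word n w"
  shows "(\<phi> \<otimes>\<^bsub>Aut_group n\<^esub> \<psi>) w = \<phi> (\<psi> w)"
  using assms by (simp add: Aut_group_def AutoGroup_def BijGroup_def auto_def compose_def)

lemma group_Aut: "group (Aut_group n)"
  unfolding Aut_group_def by (rule group.AutoGroup[OF group_W])

lemma Aut_mult_closed:
  "\<phi> \<in> auto (W n) \<Longrightarrow> \<psi> \<in> auto (W n) \<Longrightarrow> \<phi> \<otimes>\<^bsub>Aut_group n\<^esub> \<psi> \<in> auto (W n)"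
  using monoid.m_closed[OF group.is_monoid[OF group_Aut], of \<phi> n \<psi>] by simp

lemma Aut_inverse:
  assumes "\<phi> \<in> auto (W n)"
  obtains \<psi> where "\<psi> \<in> auto (W n)" "\<psi> \<otimes>\<^bsub>Aut_group n\<^esub> \<phi> = \<one>\<^bsub>Aut_group n\<^esub>"
    "\<phi> \<otimes>\<^bsub>Aut_group n\<^esub> \<psi> = \<one>\<^bsub>Aut_group n\<^esub>"
proof (rule that)
  have \<phi>: "\<phi> \<in> carrier (Aut_group n)" using assms by simp
  show "inv\<^bsub>Aut_group n\<^esub> \<phi> \<in> auto (W n)"
    using group.inv_closed[OF group_Aut \<phi>] by simp
  show "inv\<^bsub>Aut_group n\<^esub> \<phi> \<otimes>\<^bsub>Aut_group n\<^esub> \<phi> = \<one>\<^bsub>Aut_group n\<^esub>"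
    by (rule group.l_inv[OF group_Aut \<phi>])
  show "\<phi> \<otimes>\<^bsub>Aut_group n\<^esub> inv\<^bsub>Aut_group n\<^esub> \<phi> = \<one>\<^bsub>Aut_group n\<^esub>"
    by (rule group.r_inv[OF group_Aut \<phi>])
qed

lemma aut_reduced: "\<phi> \<in> auto (W n) \<Longrightarrow> reduced_word n w \<Longrightarrow> reduced_word n (\<phi> w)"
  by (auto simp: auto_def hom_def Pi_iff)

lemma aut_wmult:
  "\<phi> \<in> auto (W n) \<Longrightarrow> reduced_word n u \<Longrightarrow> reduced_word n v \<Longrightarrow>
    \<phi> (wmult u v) = wmult (\<phi> u) (\<phi> v)"
  by (auto simp: auto_def hom_def)

lemma aut_group_hom: "\<phi> \<in> auto (W n) \<Longrightarrow> group_hom (W n) (W n) \<phi>"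
  by (simp add: group_hom_def group_hom_axioms_def group_W auto_def)

lemma aut_Nil: "\<phi> \<in> auto (W n) \<Longrightarrow> \<phi> [] = []"
  using group_hom.hom_one[OF aut_group_hom] by fastforce

lemma aut_rev: "\<phi> \<in> auto (W n) \<Longrightarrow> reduced_word n u \<Longrightarrow> \<phi> (rev u) = rev (\<phi> u)"
  using group_hom.hom_inv[OF aut_group_hom, of \<phi> n u] by (simp add: inv_W aut_reduced)

lemma aut_involution:
  assumes "\<phi> \<in> auto (W n)" "w \<in> involutions (W n)"
  shows "\<phi> w \<in> involutions (W n)"
proof -
  have w: "reduced_word n w" "w \<noteq> []" "wmult w w = []"
    using assms(2) by (auto simp: involutions_def)
  have "inj_on \<phi> {w. reduced_word n w}"
    using assms(1) by (auto simp: auto_def Bij_def bij_betw_def)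
  then have "\<phi> w \<noteq> []"
    using inj_on_eq_iff[of \<phi> _ w "[]"] w aut_Nil[OF assms(1)] by simp
  moreover have "wmult (\<phi> w) (\<phi> w) = []"
    using aut_wmult[OF assms(1) w(1) w(1)] w(3) aut_Nil[OF assms(1)] by simp
  ultimately show ?thesis
    using aut_reduced[OF assms(1) w(1)] by (simp add: involutions_def)
qed

text \<open>The homomorphism from Aut(W_n) to Sym(n). For an automorphism and \<open>i < n\<close>
  the description is proper: \<open>\<phi> [i]\<close> is an involution, hence conjugate to a
  generator, and that generator is unique.\<close>

definition gen_perm :: "nat \<Rightarrow> (nat list \<Rightarrow> nat list) \<Rightarrow> nat \<Rightarrow> nat" where
  "gen_perm n \<phi> i = (THE k. k < n \<and> is_conj n k (\<phi> [i]))"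

lemma gen_perm_eqI: "is_conj n k (\<phi> [i]) \<Longrightarrow> k < n \<Longrightarrow> gen_perm n \<phi> i = k"
  unfolding gen_perm_def by (rule the_equality) (auto intro: is_conj_unique)

lemma
  assumes "\<phi> \<in> auto (W n)" "i < n"
  shows gen_perm_less: "gen_perm n \<phi> i < n"
    and is_conj_gen_perm: "is_conj n (gen_perm n \<phi> i) (\<phi> [i])"
proof -
  obtain k where "k < n" "is_conj n k (\<phi> [i])"
    using involution_is_conj aut_involution[OF assms(1) single_involution[OF assms(2)]] by blast
  then show "gen_perm n \<phi> i < n" "is_conj n (gen_perm n \<phi> i) (\<phi> [i])"
    using gen_perm_eqI[of n k \<phi> i] by auto
qed

lemma aut_is_conj:
  assumes \<phi>: "\<phi> \<in> auto (W n)" and "is_conj n k w" "k < n"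
  shows "is_conj n (gen_perm n \<phi> k) (\<phi> w)"
proof -
  obtain u where u: "reduced_word n u" "w = wmult (wmult u [k]) (rev u)"
    using assms by (auto simp: is_conj_def)
  then have "\<phi> w = wmult (wmult (\<phi> u) (\<phi> [k])) (rev (\<phi> u))"
    using assms by (simp add: aut_wmult[OF \<phi>] aut_rev[OF \<phi>] wmult_reduced)
  then show ?thesis
    using is_conj_conj[OF aut_reduced[OF \<phi> u(1)] is_conj_gen_perm[OF \<phi> \<open>k < n\<close>]
        gen_perm_less[OF \<phi> \<open>k < n\<close>]] by simp
qed

lemma gen_perm_mult:
  assumes "\<phi> \<in> auto (W n)" "\<psi> \<in> auto (W n)" "i < n"
  shows "gen_perm n (\<phi> \<otimes>\<^bsub>Aut_group n\<^esub> \<psi>) i = gen_perm n \<phi> (gen_perm n \<psi> i)"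
  using assms
  by (intro gen_perm_eqI)
     (auto simp: Aut_mult_apply intro!: gen_perm_less aut_is_conj is_conj_gen_perm)

lemma gen_perm_one: "i < n \<Longrightarrow> gen_perm n (\<one>\<^bsub>Aut_group n\<^esub>) i = i"
  by (intro gen_perm_eqI) (auto simp: one_Aut intro: is_conj_self)

text \<open>The map induced by the inverse automorphism is a left inverse.\<close>

lemma gen_perm_inj:
  assumes \<phi>: "\<phi> \<in> auto (W n)" and ij: "i < n" "j < n" "gen_perm n \<phi> i = gen_perm n \<phi> j"
  shows "i = j"
proof -
  obtain \<psi> where \<psi>: "\<psi> \<in> auto (W n)" and one: "\<psi> \<otimes>\<^bsub>Aut_group n\<^esub> \<phi> = \<one>\<^bsub>Aut_group n\<^esub>"
    by (rule Aut_inverse[OF \<phi>])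
  have inv: "gen_perm n \<psi> (gen_perm n \<phi> k) = k" if "k < n" for k
    using gen_perm_mult[OF \<psi> \<phi> that] gen_perm_one[OF that] unfolding one by simp
  show ?thesis using inv[OF ij(1)] unfolding ij(3) inv[OF ij(2)] by (rule sym)
qed

section \<open>The action of automorphisms on dihedral lines\<close>

definition dihedral :: "nat \<Rightarrow> nat \<Rightarrow> nat \<Rightarrow> int \<Rightarrow> int" where
  "dihedral i j k = (if k = i then \<lambda>x. - x else if k = j then \<lambda>x. 2 - x else id)"

abbreviation dihedral_act :: "nat \<Rightarrow> nat \<Rightarrow> nat list \<Rightarrow> int \<Rightarrow> int" where
  "dihedral_act i j \<equiv> letters_act (dihedral i j)"

lemma dihedral_simps [simp]:
  "dihedral i j i x = - x"
  "i \<noteq> j \<Longrightarrow> dihedral i j j x = 2 - x"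
  "k \<noteq> i \<Longrightarrow> k \<noteq> j \<Longrightarrow> dihedral i j k x = x"
  by (simp_all add: dihedral_def)

lemma dihedral_involutive: "dihedral i j k \<circ> dihedral i j k = id"
  by (auto simp: dihedral_def)

text \<open>The translation part is even because reflections in integers preserve parity. This is
  what later keeps the two classes of reflections apart and rules out inversions.\<close>

lemma dihedral_act_affine:
  "\<exists>s c. (s = 1 \<or> s = -1) \<and> dihedral_act i j w = (\<lambda>x. s * x + 2 * c)"
proof (induction w)
  case Nil
  show ?case by (rule exI[of _ 1], rule exI[of _ 0]) auto
next
  case (Cons k w)
  then obtain s c where sc: "s = 1 \<or> s = -1" "dihedral_act i j w = (\<lambda>x. s * x + 2 * c)" by blast
  consider "k = i" | "k \<noteq> i" "k = j" | "k \<noteq> i" "k \<noteq> j" by blast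
  then show ?case
  proof cases
    case 1
    then show ?thesis using sc
      by (intro exI[of _ "-s"] exI[of _ "-c"]) (auto simp: fun_eq_iff)
  next
    case 2
    then show ?thesis using sc
      by (intro exI[of _ "-s"] exI[of _ "1-c"]) (auto simp: fun_eq_iff)
  next
    case 3
    then show ?thesis using sc
      by (intro exI[of _ "s"] exI[of _ "c"]) (auto simp: fun_eq_iff)
  qed
qed

text \<open>Conjugating the reflection in p by an isometry g gives the reflection in g(p). Here g
  preserves parity, so conjugates of \<open>i\<close> have even centres, those of \<open>j\<close>
  odd ones.\<close>

lemma dihedral_act_conj:
  assumes "is_conj n k w" "k < n" "i \<noteq> j"
  shows "k = i \<Longrightarrow> \<exists>a. even a \<and> dihedral_act i j w = (\<lambda>x. 2 * a - x)"
    and "k = j \<Longrightarrow> \<exists>a. odd a \<and> dihedral_act i j w = (\<lambda>x. 2 * a - x)"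
    and "k \<noteq> i \<Longrightarrow> k \<noteq> j \<Longrightarrow> dihedral_act i j w = id"
proof -
  obtain u where u: "reduced_word n u" "w = wmult (wmult u [k]) (rev u)"
    using assms by (auto simp: is_conj_def)
  obtain s c where s: "s = 1 \<or> s = -1" and act: "dihedral_act i j u = (\<lambda>x. s * x + 2 * c)"
    using dihedral_act_affine by blast
  have w: "dihedral_act i j w x = s * dihedral i j k (dihedral_act i j (rev u) x) + 2 * c" for x
    unfolding u(2) letters_act_conj[OF dihedral_involutive u(1) assms(2)] by (simp add: act)
  have inv: "s * dihedral_act i j (rev u) x + 2 * c = x" for x
    using letters_act_rev[where r = "dihedral i j" and x = x, OF dihedral_involutive u(1)] by (simp add: act)
  show "\<exists>a. even a \<and> dihedral_act i j w = (\<lambda>x. 2 * a - x)" if "k = i"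
  \<comment> \<open>The centre is the image of the vertex 0 under \<open>u\<close>.\<close>
  proof (intro exI[of _ "2 * c"] conjI ext)
    fix x show "dihedral_act i j w x = 2 * (2 * c) - x"
      using w[of x] inv[of x] that by simp
  qed simp
  show "\<exists>a. odd a \<and> dihedral_act i j w = (\<lambda>x. 2 * a - x)" if "k = j"
  \<comment> \<open>The centre is the image of the vertex 1 under \<open>u\<close>.\<close>
  proof (intro exI[of _ "s + 2 * c"] conjI ext)
    fix x show "dihedral_act i j w x = 2 * (s + 2 * c) - x"
      using w[of x] inv[of x] that assms(3) by (simp add: algebra_simps)
  qed (use s in auto)
  show "dihedral_act i j w = id" if "k \<noteq> i" "k \<noteq> j"
    using w inv that by (auto simp: fun_eq_iff)
qed

text \<open>The image of the letter \<open>k\<close> under \<open>\<phi>\<close>, for \<open>k = i\<close> or \<open>k = j\<close>, is the reflection in this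
  integer; a reflection maps 0 to twice its fixed point.\<close>
definition centre :: "nat \<Rightarrow> (nat list \<Rightarrow> nat list) \<Rightarrow> nat \<Rightarrow> nat \<Rightarrow> nat \<Rightarrow> int" where
  "centre n \<phi> i j k = dihedral_act (gen_perm n \<phi> i) (gen_perm n \<phi> j) (\<phi> [k]) 0 div 2"

text \<open>An equivariant map must send the vertices 0 and 1, fixed by the letters \<open>i\<close>
  and \<open>j\<close>, to the centres of the images of these letters. This is the affine map with
  those two values.\<close>

definition line_map :: "nat \<Rightarrow> (nat list \<Rightarrow> nat list) \<Rightarrow> nat \<Rightarrow> nat \<Rightarrow> int \<Rightarrow> int" where
  "line_map n \<phi> i j m = centre n \<phi> i j i + m * (centre n \<phi> i j j - centre n \<phi> i j i)"

lemma centre_reflection: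
  assumes \<phi>: "\<phi> \<in> auto (W n)" and ij: "i < n" "j < n" "i \<noteq> j"
  shows "even (centre n \<phi> i j i)" "odd (centre n \<phi> i j j)"
    and "dihedral_act (gen_perm n \<phi> i) (gen_perm n \<phi> j) (\<phi> [i]) x = 2 * centre n \<phi> i j i - x"
    and "dihedral_act (gen_perm n \<phi> i) (gen_perm n \<phi> j) (\<phi> [j]) x = 2 * centre n \<phi> i j j - x"
proof -
  have ne: "gen_perm n \<phi> i \<noteq> gen_perm n \<phi> j" using gen_perm_inj[OF \<phi>] ij by blast
  obtain a where "even a"
      "dihedral_act (gen_perm n \<phi> i) (gen_perm n \<phi> j) (\<phi> [i]) = (\<lambda>x. 2 * a - x)"
    using dihedral_act_conj(1)[OF is_conj_gen_perm[OF \<phi> ij(1)] gen_perm_less[OF \<phi> ij(1)] ne] by blast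
  then show "even (centre n \<phi> i j i)"
    "dihedral_act (gen_perm n \<phi> i) (gen_perm n \<phi> j) (\<phi> [i]) x = 2 * centre n \<phi> i j i - x"
    by (simp_all add: centre_def)
  obtain b where "odd b"
      "dihedral_act (gen_perm n \<phi> i) (gen_perm n \<phi> j) (\<phi> [j]) = (\<lambda>x. 2 * b - x)"
    using dihedral_act_conj(2)[OF is_conj_gen_perm[OF \<phi> ij(2)] gen_perm_less[OF \<phi> ij(2)] ne] by blast
  then show "odd (centre n \<phi> i j j)"
    "dihedral_act (gen_perm n \<phi> i) (gen_perm n \<phi> j) (\<phi> [j]) x = 2 * centre n \<phi> i j j - x"
    by (simp_all add: centre_def)
qed

text \<open>It suffices to check letters. For \<open>i\<close> and \<open>j\<close>, an affine map
  intertwines the reflection in a vertex with the reflection in the image of that vertex. Any other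
  letter acts trivially on both lines, since its class is sent to neither of the two image
  classes.\<close>

lemma line_map_equivariant:
  assumes \<phi>: "\<phi> \<in> auto (W n)" and ij: "i < n" "j < n" "i \<noteq> j" and w: "reduced_word n w"
  shows "dihedral_act (gen_perm n \<phi> i) (gen_perm n \<phi> j) (\<phi> w) (line_map n \<phi> i j m) =
    line_map n \<phi> i j (dihedral_act i j w m)"
  using w
proof (induction w)
  case Nil
  then show ?case by (simp add: aut_Nil[OF \<phi>])
next
  case (Cons k w)
  let ?r = "dihedral_act (gen_perm n \<phi> i) (gen_perm n \<phi> j)"
  have k: "k < n" and w: "reduced_word n w" using Cons.prems by (auto simp: reduced_word_Cons)
  have "k # w = wmult [k] w"
    using wmult_conv_foldr[of n "[k]" w] push_Cons[OF Cons.prems] k w by simp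
  then have "\<phi> (k # w) = wmult (\<phi> [k]) (\<phi> w)"
    using aut_wmult[OF \<phi> _ w, of "[k]"] k by simp
  then have "?r (\<phi> (k # w)) = ?r (\<phi> [k]) \<circ> ?r (\<phi> w)"
    using letters_act_wmult[OF dihedral_involutive aut_reduced[OF \<phi>] aut_reduced[OF \<phi> w], of "[k]"] k
    by simp
  moreover have "?r (\<phi> [k]) (line_map n \<phi> i j x) = line_map n \<phi> i j (dihedral i j k x)" for x
  proof -
    consider "k = i" | "k = j" | "k \<noteq> i" "k \<noteq> j" by blast
    then show ?thesis
    proof cases
      case 1
      then show ?thesis
        using centre_reflection(3)[OF \<phi> ij] by (simp add: line_map_def)
    next
      case 2
      then show ?thesis
        unfolding \<open>k = j\<close> centre_reflection(4)[OF \<phi> ij] using ij(3)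
        by (simp add: line_map_def algebra_simps)
    next
      case 3
      then have "?r (\<phi> [k]) = id"
        using gen_perm_inj[OF \<phi> k ij(1)] gen_perm_inj[OF \<phi> k ij(2)]
          gen_perm_inj[OF \<phi> ij(1,2)] ij
        by (intro dihedral_act_conj(3)[OF is_conj_gen_perm[OF \<phi> k] gen_perm_less[OF \<phi> k]]) auto
      then show ?thesis using 3 by simp
    qed
  qed
  ultimately show ?case using Cons.IH[OF w] by simp
qed

text \<open>Both sides are affine in \<open>m\<close>, so they need only agree at 0 and 1, that is,
  on centres.\<close>

lemma line_map_mult:
  assumes \<phi>: "\<phi> \<in> auto (W n)" and \<psi>: "\<psi> \<in> auto (W n)" and ij: "i < n" "j < n" "i \<noteq> j"
  shows "line_map n (\<phi> \<otimes>\<^bsub>Aut_group n\<^esub> \<psi>) i j m =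
    line_map n \<phi> (gen_perm n \<psi> i) (gen_perm n \<psi> j) (line_map n \<psi> i j m)"
proof -
  let ?\<chi> = "\<phi> \<otimes>\<^bsub>Aut_group n\<^esub> \<psi>" and ?k = "gen_perm n \<psi> i" and ?l = "gen_perm n \<psi> j"
  have \<chi>: "?\<chi> \<in> auto (W n)" by (rule Aut_mult_closed[OF \<phi> \<psi>])
  have kl: "?k < n" "?l < n" "?k \<noteq> ?l"
    using gen_perm_less[OF \<psi>] gen_perm_inj[OF \<psi>] ij by blast+
  have perm: "gen_perm n ?\<chi> i = gen_perm n \<phi> ?k" "gen_perm n ?\<chi> j = gen_perm n \<phi> ?l"
    using gen_perm_mult[OF \<phi> \<psi>] ij by auto
  have red: "reduced_word n [i]" "reduced_word n [j]" using ij by auto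
  note app = Aut_mult_apply[OF \<phi> \<psi> red(1)] Aut_mult_apply[OF \<phi> \<psi> red(2)]
  \<comment> \<open>Equivariance for the word \<open>\<psi> [i]\<close>, evaluated at the vertex 0.
    As the line map is affine, halving this identity shows that it carries the centre for \<psi> to
    the centre for the product.\<close>
  have 1: "2 * centre n ?\<chi> i j i - line_map n \<phi> ?k ?l 0 =
      line_map n \<phi> ?k ?l (2 * centre n \<psi> i j i - 0)"
    using line_map_equivariant[OF \<phi> kl aut_reduced[OF \<psi> red(1)], of 0]
    unfolding centre_reflection(3)[OF \<psi> ij]
    using centre_reflection(3)[OF \<chi> ij] by (simp add: perm app)
  have 2: "2 * centre n ?\<chi> i j j - line_map n \<phi> ?k ?l 0 =
      line_map n \<phi> ?k ?l (2 * centre n \<psi> i j j - 0)"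
    using line_map_equivariant[OF \<phi> kl aut_reduced[OF \<psi> red(2)], of 0]
    unfolding centre_reflection(4)[OF \<psi> ij]
    using centre_reflection(4)[OF \<chi> ij] by (simp add: perm app)
  have c: "centre n ?\<chi> i j i = line_map n \<phi> ?k ?l (centre n \<psi> i j i)"
    "centre n ?\<chi> i j j = line_map n \<phi> ?k ?l (centre n \<psi> i j j)"
    using 1 2 unfolding line_map_def by (simp_all add: algebra_simps)
  show ?thesis
    unfolding line_map_def[of n ?\<chi>] c by (simp add: line_map_def algebra_simps)
qed

lemma line_map_one:
  assumes "i < n" "j < n" "i \<noteq> j"
  shows "line_map n (\<one>\<^bsub>Aut_group n\<^esub>) i j m = m"
  using assms gen_perm_one[of i n] gen_perm_one[of j n]
  by (simp add: line_map_def centre_def one_Aut)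

text \<open>The line map of the inverse automorphism undoes this one, so the product of the two
  integer slopes is 1.\<close>

lemma line_map_isometry:
  assumes \<phi>: "\<phi> \<in> auto (W n)" and ij: "i < n" "j < n" "i \<noteq> j"
  obtains s where "s = 1 \<or> s = -1" "\<And>m. line_map n \<phi> i j m = centre n \<phi> i j i + s * m"
proof -
  obtain \<psi> where \<psi>: "\<psi> \<in> auto (W n)" and one: "\<psi> \<otimes>\<^bsub>Aut_group n\<^esub> \<phi> = \<one>\<^bsub>Aut_group n\<^esub>"
    by (rule Aut_inverse[OF \<phi>])
  let ?k = "gen_perm n \<phi> i" and ?l = "gen_perm n \<phi> j"
  let ?s = "centre n \<phi> i j j - centre n \<phi> i j i"
  let ?t = "centre n \<psi> ?k ?l ?l - centre n \<psi> ?k ?l ?k"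
  have inv: "line_map n \<psi> ?k ?l (line_map n \<phi> i j m) = m" for m
    using line_map_mult[OF \<psi> \<phi> ij, of m] line_map_one[OF ij] unfolding one by simp
  have "?s * ?t = 1"
    using inv[of 0] inv[of 1] unfolding line_map_def by (simp add: algebra_simps)
  then have "?s = 1 \<or> ?s = -1" using zmult_eq_1_iff by blast
  then show ?thesis by (rule that) (simp add: line_map_def)
qed

section \<open>The action of Aut(W_n) on the union of the lines\<close>

definition pairs :: "nat \<Rightarrow> (nat \<times> nat) set" where
  "pairs n = {(i, j). i < n \<and> j < n \<and> i \<noteq> j}"

definition lines_act :: "nat \<Rightarrow> (nat list \<Rightarrow> nat list) \<Rightarrow> (nat \<times> nat) \<times> int \<Rightarrow> (nat \<times> nat) \<times> int" where
  "lines_act n \<phi> = (\<lambda>((i, j), m). ((gen_perm n \<phi> i, gen_perm n \<phi> j), line_map n \<phi> i j m))"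

lemma finite_pairs: "finite (pairs n)"
  by (rule finite_subset[of _ "{..<n} \<times> {..<n}"]) (auto simp: pairs_def)

lemma lines_act_in:
  "\<phi> \<in> auto (W n) \<Longrightarrow> x \<in> pairs n \<times> UNIV \<Longrightarrow> lines_act n \<phi> x \<in> pairs n \<times> UNIV"
  by (auto simp: lines_act_def pairs_def gen_perm_less dest: gen_perm_inj)

lemma lines_act_mult:
  "\<phi> \<in> auto (W n) \<Longrightarrow> \<psi> \<in> auto (W n) \<Longrightarrow> x \<in> pairs n \<times> UNIV \<Longrightarrow>
    lines_act n (\<phi> \<otimes>\<^bsub>Aut_group n\<^esub> \<psi>) x = lines_act n \<phi> (lines_act n \<psi> x)"
  by (auto simp: lines_act_def pairs_def gen_perm_mult line_map_mult)

lemma lines_act_one: "x \<in> pairs n \<times> UNIV \<Longrightarrow> lines_act n (\<one>\<^bsub>Aut_group n\<^esub>) x = x"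
  using gen_perm_one line_map_one by (force simp: lines_act_def pairs_def)

lemma bij_lines_act:
  assumes \<phi>: "\<phi> \<in> auto (W n)"
  shows "bij_betw (lines_act n \<phi>) (pairs n \<times> UNIV) (pairs n \<times> UNIV)"
proof -
  obtain \<psi> where \<psi>: "\<psi> \<in> auto (W n)" and one: "\<psi> \<otimes>\<^bsub>Aut_group n\<^esub> \<phi> = \<one>\<^bsub>Aut_group n\<^esub>"
    "\<phi> \<otimes>\<^bsub>Aut_group n\<^esub> \<psi> = \<one>\<^bsub>Aut_group n\<^esub>"
    by (rule Aut_inverse[OF \<phi>])
  show ?thesis
  proof (rule bij_betw_byWitness[where f' = "lines_act n \<psi>"])
    show "\<forall>x\<in>pairs n \<times> UNIV. lines_act n \<psi> (lines_act n \<phi> x) = x"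
      using lines_act_mult[OF \<psi> \<phi>] lines_act_one[of _ n] unfolding one by metis
    show "\<forall>x\<in>pairs n \<times> UNIV. lines_act n \<phi> (lines_act n \<psi> x) = x"
      using lines_act_mult[OF \<phi> \<psi>] lines_act_one[of _ n] unfolding one by metis
  qed (use lines_act_in \<phi> \<psi> in blast)+
qed

section \<open>Inner and special automorphisms\<close>

text \<open>Restricted to the carrier because members of \<open>auto\<close> are extensional
  functions.\<close>

definition inner_aut :: "nat \<Rightarrow> nat list \<Rightarrow> nat list \<Rightarrow> nat list" where
  "inner_aut n u = (\<lambda>w\<in>{w. reduced_word n w}. wmult (wmult u w) (rev u))"

lemma inner_aut_in_auto:
  assumes u: "reduced_word n u"
  shows "inner_aut n u \<in> auto (W n)"
proof -
  interpret group "W n" by (rule group_W)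
  have cancel: "wmult (rev u) (wmult u v) = v" "wmult u (wmult (rev u) v) = v"
    if "reduced_word n v" for v
    using u that by (simp_all flip: wmult_assoc[of n] add: wmult_rev_left wmult_rev_right)
  have "inner_aut n u \<in> hom (W n) (W n)"
    using u by (auto simp: hom_def inner_aut_def wmult_reduced wmult_assoc[of n] cancel)
  moreover have "bij_betw (inner_aut n u) {w. reduced_word n w} {w. reduced_word n w}"
    using u by (intro bij_betw_byWitness[where f' = "inner_aut n (rev u)"])
      (auto simp: inner_aut_def wmult_reduced wmult_assoc[of n] cancel wmult_rev_left wmult_rev_right)
  ultimately show ?thesis
    by (simp add: auto_def Bij_def) (simp add: inner_aut_def)
qed

lemma (in group) conj_class_conj:
  assumes "g \<in> carrier G" "x \<in> carrier G"
  shows "conj_class G (g \<otimes> x \<otimes> inv g) = conj_class G x"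
proof (intro equalityI subsetI)
  fix y assume "y \<in> conj_class G (g \<otimes> x \<otimes> inv g)"
  then obtain h where h: "h \<in> carrier G" "y = h \<otimes> (g \<otimes> x \<otimes> inv g) \<otimes> inv h"
    by (auto simp: conj_class_def)
  then have "y = (h \<otimes> g) \<otimes> x \<otimes> inv (h \<otimes> g)"
    using assms by (simp add: m_assoc inv_mult_group)
  then show "y \<in> conj_class G x" using assms h unfolding conj_class_def by blast
next
  have cancel: "inv g \<otimes> (g \<otimes> z) = z" if "z \<in> carrier G" for z
    using assms that by (simp flip: m_assoc)
  fix y assume "y \<in> conj_class G x"
  then obtain h where h: "h \<in> carrier G" "y = h \<otimes> x \<otimes> inv h" by (auto simp: conj_class_def)
  then have "y = (h \<otimes> inv g) \<otimes> (g \<otimes> x \<otimes> inv g) \<otimes> inv (h \<otimes> inv g)"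
    using assms by (simp add: m_assoc inv_mult_group cancel)
  then show "y \<in> conj_class G (g \<otimes> x \<otimes> inv g)"
    using assms h unfolding conj_class_def by blast
qed

lemma inner_aut_in_Spe:
  assumes u: "reduced_word n u"
  shows "inner_aut n u \<in> Spe_set n"
proof -
  have "conj_class (W n) (inner_aut n u x) = conj_class (W n) x" if "x \<in> involutions (W n)" for x
    using group.conj_class_conj[OF group_W, of u n x] that u
    by (simp add: inner_aut_def inv_W involutions_def)
  then show ?thesis using inner_aut_in_auto[OF u] by (simp add: Spe_set_def)
qed

lemma Spe_subset: "Spe_set n \<subseteq> auto (W n)"
  by (auto simp: Spe_set_def)

lemma Spe_one: "\<one>\<^bsub>Aut_group n\<^esub> \<in> Spe_set n"
  using group.id_in_auto[OF group_W, of n] by (simp add: Spe_set_def involutions_def one_Aut)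

lemma Spe_mult:
  assumes "\<phi> \<in> Spe_set n" "\<psi> \<in> Spe_set n"
  shows "\<phi> \<otimes>\<^bsub>Aut_group n\<^esub> \<psi> \<in> Spe_set n"
proof -
  have aut: "\<phi> \<in> auto (W n)" "\<psi> \<in> auto (W n)" using assms Spe_subset by auto
  then have "\<phi> \<otimes>\<^bsub>Aut_group n\<^esub> \<psi> \<in> auto (W n)" by (rule Aut_mult_closed)
  moreover have "conj_class (W n) ((\<phi> \<otimes>\<^bsub>Aut_group n\<^esub> \<psi>) x) = conj_class (W n) x"
    if x: "x \<in> involutions (W n)" for x
  proof -
    have "reduced_word n x" using x by (simp add: involutions_def)
    then show ?thesis
      using assms aut_involution[OF aut(2) x] x by (simp add: Spe_set_def Aut_mult_apply aut)
  qed
  ultimately show ?thesis by (simp add: Spe_set_def)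
qed

text \<open>The generator \<open>[i]\<close> is an involution, so its conjugacy class is one of
  those that \<phi> fixes.\<close>

lemma gen_perm_Spe:
  assumes "\<phi> \<in> Spe_set n" "i < n"
  shows "gen_perm n \<phi> i = i"
proof (rule gen_perm_eqI[OF _ assms(2)])
  interpret group "W n" by (rule group_W)
  have red: "reduced_word n (\<phi> [i])" using aut_reduced[of \<phi> n "[i]"] assms Spe_subset by auto
  have "\<phi> [i] \<in> conj_class (W n) (\<phi> [i])"
    unfolding conj_class_def using red one_closed inv_one
    by (auto intro!: exI[of _ "[]"] simp: inv_W)
  then have "\<phi> [i] \<in> conj_class (W n) [i]"
    using assms single_involution[OF assms(2)] by (auto simp: Spe_set_def)
  then show "is_conj n i (\<phi> [i])" by (auto simp: conj_class_def is_conj_def inv_W)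
qed

text \<open>Conjugation by a generator acts on the line as that generator does. The two reflections
  have no common fixed vertex, and their product is a translation by 2.\<close>

lemma
  assumes ij: "i < n" "j < n" "i \<noteq> j"
  shows line_map_inner_left: "line_map n (inner_aut n [i]) i j m = - m"
    and line_map_inner_right: "line_map n (inner_aut n [j]) i j m = 2 - m"
proof -
  have red: "reduced_word n [i]" "reduced_word n [j]" using ij by auto
  have conj: "dihedral_act i j (inner_aut n [k] [l]) 0 =
      dihedral i j k (dihedral i j l (dihedral i j k 0))" if "k < n" "l < n" for k l
    using letters_act_conj[where r = "dihedral i j" and u = "[k]" and k = l, OF dihedral_involutive] that
    by (simp add: inner_aut_def)
  note perm = gen_perm_Spe[OF inner_aut_in_Spe]
  show "line_map n (inner_aut n [i]) i j m = - m"
    using ij by (simp add: line_map_def centre_def perm conj)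
  show "line_map n (inner_aut n [j]) i j m = 2 - m"
    using ij by (simp add: line_map_def centre_def perm conj)
qed

section \<open>The simplicial line\<close>

text \<open>The map \<iota> copies the integers into the vertex type, of which only infinitude will
  be known.\<close>

definition line_edges :: "(int \<Rightarrow> 'v) \<Rightarrow> ('v \<times> 'v) set" where
  "line_edges \<iota> = {(\<iota> m, \<iota> m') | m m'. \<bar>m - m'\<bar> = 1}"

lemma line_edges_iff: "inj \<iota> \<Longrightarrow> (\<iota> m, \<iota> m') \<in> line_edges \<iota> \<longleftrightarrow> \<bar>m - m'\<bar> = 1"
  by (auto simp: line_edges_def inj_eq)

text \<open>Steps have length 1 and may not be undone at once, so all of them equal the first step
  \<open>d\<close>. The walk is an arithmetic progression with nonzero difference and cannot
  return.\<close>

lemma line_walk_ends: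
  assumes \<iota>: "inj \<iota>" and walk: "is_walk (line_edges \<iota>) xs"
    and nb: "no_backtracking xs" and len: "length xs \<ge> 2"
  shows "hd xs \<noteq> last xs"
proof -
  define g where "g i = inv_into UNIV \<iota> (xs ! i)" for i
  have edge: "\<exists>m m'. xs ! i = \<iota> m \<and> xs ! Suc i = \<iota> m' \<and> \<bar>m - m'\<bar> = 1" if "Suc i < length xs" for i
    using walk that by (force simp: is_walk_def line_edges_def)
  have step: "\<bar>g i - g (Suc i)\<bar> = 1" if "Suc i < length xs" for i
    using edge[OF that] \<iota> by (auto simp: g_def)
  have g: "xs ! i = \<iota> (g i)" if "i < length xs" for i
  proof (cases "Suc i < length xs")
    case True
    then show ?thesis using edge[OF True] \<iota> by (auto simp: g_def)
  next
    case False
    \<comment> \<open>The last position starts no edge, so it is read off as the end of the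
      preceding one, which exists because the walk has length at least 2.\<close>
    then obtain j where "i = Suc j" using len by (cases i) auto
    then show ?thesis using edge[of j] that \<iota> by (auto simp: g_def)
  qed
  define d where "d = g 1 - g 0"
  have "g (Suc i) - g i = d" if "Suc i < length xs" for i
    using that
  proof (induction i)
    case (Suc i)
    have "g i \<noteq> g (Suc (Suc i))"
      using nb Suc.prems g[of i] g[of "Suc (Suc i)"] by (auto simp: no_backtracking_def)
    then show ?case using step[of i] step[of "Suc i"] Suc by simp
  qed (simp add: d_def)
  then have lin: "i < length xs \<Longrightarrow> g i = g 0 + int i * d" for i
  proof (induction i)
    case (Suc i)
    then have "g (Suc i) = g i + d" by (metis add_diff_cancel_left' add.commute diff_add_cancel)
    then show ?case using Suc by (simp add: algebra_simps)
  qed simp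
  have "\<bar>d\<bar> = 1" using step[of 0] len by (simp add: d_def abs_minus_commute)
  moreover have "g (length xs - 1) = g 0 + int (length xs - 1) * d"
    using len by (intro lin) auto
  ultimately have "g (length xs - 1) \<noteq> g 0" using len by auto
  moreover have "hd xs = \<iota> (g 0)" "last xs = \<iota> (g (length xs - 1))"
    using walk g[of 0] g[of "length xs - 1"]
    by (simp_all add: is_walk_def hd_conv_nth last_conv_nth)
  ultimately show ?thesis using \<iota> by (simp add: inj_eq)
qed

lemma line_tree:
  assumes \<iota>: "inj \<iota>"
  shows "simplicial_tree (range \<iota>) (line_edges \<iota>)"
proof -
  have up: "(\<iota> m, \<iota> (m + int k)) \<in> (line_edges \<iota>)\<^sup>*" for m k
  proof (induction k)
    case (Suc k)
    have "(\<iota> (m + int k), \<iota> (m + int (Suc k))) \<in> line_edges \<iota>"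
      by (simp add: line_edges_iff[OF \<iota>])
    with Suc show ?case by (rule rtrancl_into_rtrancl)
  qed simp
  have sym: "sym (line_edges \<iota>)"
    unfolding line_edges_def sym_def using abs_minus_commute by fastforce
  have conn: "(\<iota> m, \<iota> m') \<in> (line_edges \<iota>)\<^sup>*" for m m'
  proof (cases "m \<le> m'")
    case True
    then show ?thesis using up[of m "nat (m' - m)"] by simp
  next
    case False
    then have "(\<iota> m', \<iota> m) \<in> (line_edges \<iota>)\<^sup>*" using up[of m' "nat (m - m')"] by simp
    then show ?thesis using sym by (meson sym_rtrancl symD)
  qed
  have "line_edges \<iota> \<subseteq> range \<iota> \<times> range \<iota>" "\<forall>v. (v, v) \<notin> line_edges \<iota>"
    using \<iota> by (auto simp: line_edges_def inj_eq)
  then show ?thesis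
    unfolding simplicial_tree_def using sym conn line_walk_ends[OF \<iota>] by blast
qed

section \<open>Permutation representations\<close>

definition orthonormal_on :: "'x set \<Rightarrow> ('x \<Rightarrow> 'h::real_inner) \<Rightarrow> bool" where
  "orthonormal_on X b \<longleftrightarrow> (\<forall>x\<in>X. \<forall>y\<in>X. b x \<bullet> b y = (if x = y then 1 else 0))"

lemma orthonormal_onD:
  "orthonormal_on X b \<Longrightarrow> x \<in> X \<Longrightarrow> y \<in> X \<Longrightarrow> b x \<bullet> b y = (if x = y then 1 else 0)"
  by (simp add: orthonormal_on_def)

lemma orthonormal_on_comp:
  assumes "orthonormal_on X b" "inj_on f A" "f ` A \<subseteq> X"
  shows "orthonormal_on A (b \<circ> f)"
  using assms by (auto simp: orthonormal_on_def inj_on_eq_iff image_subset_iff)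

lemma inner_sum_orthonormal_single:
  assumes "orthonormal_on X b" "finite F" "F \<subseteq> X" "m \<in> X"
  shows "(\<Sum>k\<in>F. c k *\<^sub>R b k) \<bullet> b m = (if m \<in> F then c m else 0)"
proof -
  have "(\<Sum>k\<in>F. c k *\<^sub>R b k) \<bullet> b m = (\<Sum>k\<in>F. if m = k then c k else 0)"
    unfolding inner_sum_left using assms(3,4)
    by (intro sum.cong refl) (auto simp: orthonormal_onD[OF assms(1)] subset_iff)
  then show ?thesis using assms(2) by simp
qed

lemma inner_sum_orthonormal:
  assumes "orthonormal_on X b" "finite F" "F \<subseteq> X"
  shows "(\<Sum>k\<in>F. c k *\<^sub>R b k) \<bullet> (\<Sum>k\<in>F. d k *\<^sub>R b k) = (\<Sum>k\<in>F. c k * d k)"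
proof -
  have "(\<Sum>k\<in>F. c k *\<^sub>R b k) \<bullet> (\<Sum>k\<in>F. d k *\<^sub>R b k) =
      (\<Sum>k\<in>F. d k * ((\<Sum>k\<in>F. c k *\<^sub>R b k) \<bullet> b k))"
    by (simp only: inner_sum_right inner_scaleR_right)
  also have "\<dots> = (\<Sum>k\<in>F. c k * d k)"
    using subsetD[OF assms(3)]
    by (intro sum.cong refl) (simp add: inner_sum_orthonormal_single[OF assms])
  finally show ?thesis .
qed

lemma norm_sum_orthonormal:
  assumes "orthonormal_on X b" "finite F" "F \<subseteq> X"
  shows "(norm (\<Sum>k\<in>F. c k *\<^sub>R b k))\<^sup>2 = (\<Sum>k\<in>F. (c k)\<^sup>2)"
  unfolding power2_norm_eq_inner using inner_sum_orthonormal[OF assms, of c c]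
  by (simp add: power2_eq_square)

text \<open>Expand the squared norm of \<open>x\<close> minus its projection to the span of the
  finite family.\<close>

lemma Bessel_finite:
  assumes "orthonormal_on X b" "finite F" "F \<subseteq> X"
  shows "(\<Sum>k\<in>F. (x \<bullet> b k)\<^sup>2) \<le> (norm x)\<^sup>2"
proof -
  let ?s = "\<Sum>k\<in>F. (x \<bullet> b k) *\<^sub>R b k"
  have "x \<bullet> ?s = (\<Sum>k\<in>F. (x \<bullet> b k)\<^sup>2)"
    by (simp add: inner_sum_right power2_eq_square)
  moreover have "?s \<bullet> ?s = (\<Sum>k\<in>F. (x \<bullet> b k)\<^sup>2)"
    using inner_sum_orthonormal[OF assms] by (simp add: power2_eq_square)
  moreover have "0 \<le> (x - ?s) \<bullet> (x - ?s)" by (rule inner_ge_zero)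
  ultimately show ?thesis
    by (simp add: inner_diff_left inner_diff_right inner_commute power2_norm_eq_inner)
qed

text \<open>The closed span of \<open>b ` X\<close>, encoded as a double orthogonal complement.\<close>
definition orth_span :: "'x set \<Rightarrow> ('x \<Rightarrow> 'h::real_inner) \<Rightarrow> 'h set" where
  "orth_span X b = {x. \<forall>z. (\<forall>k\<in>X. z \<bullet> b k = 0) \<longrightarrow> z \<bullet> x = 0}"

lemma subspace_orth_span: "subspace (orth_span X b)"
  by (auto simp: orth_span_def subspace_def inner_add_right)

lemma closed_orth_span: "closed (orth_span X b)"
proof -
  have "orth_span X b = (\<Inter>z\<in>{z. \<forall>k\<in>X. z \<bullet> b k = 0}. {x. z \<bullet> x = 0})"
    by (auto simp: orth_span_def)
  then show ?thesis by (auto intro!: closed_INT closed_hyperplane)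
qed

lemma orth_span_base: "k \<in> X \<Longrightarrow> b k \<in> orth_span X b"
  by (auto simp: orth_span_def)

lemma orth_span_sum: "F \<subseteq> X \<Longrightarrow> (\<Sum>k\<in>F. c k *\<^sub>R b k) \<in> orth_span X b"
  by (intro subspace_sum[OF subspace_orth_span] subspace_scale[OF subspace_orth_span])
     (auto intro: orth_span_base)

text \<open>The difference lies in the double complement and is orthogonal to the family, hence
  orthogonal to itself. Vectors of the closed span are thus determined by their
  coefficients.\<close>

lemma orth_span_eqI:
  assumes "x \<in> orth_span X b" "y \<in> orth_span X b" "\<And>k. k \<in> X \<Longrightarrow> x \<bullet> b k = y \<bullet> b k"
  shows "x = y"
proof -
  have "x - y \<in> orth_span X b"
    using assms by (intro subspace_diff subspace_orth_span)
  moreover have "\<forall>k\<in>X. (x - y) \<bullet> b k = 0" using assms(3) by (simp add: inner_diff_left)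
  ultimately have "(x - y) \<bullet> (x - y) = 0" by (auto simp: orth_span_def)
  then show ?thesis by simp
qed

text \<open>Riesz-Fischer, with the coefficients of \<open>x\<close> along \<open>e\<close> attached
  to a second family \<open>d\<close>. Bessel's inequality makes the squared coefficients summable,
  so the partial sums are Cauchy and completeness gives the limit.\<close>

lemma orthonormal_series:
  fixes e d :: "nat \<Rightarrow> 'h::{real_inner, complete_space}"
  assumes e: "orthonormal_on UNIV e" and d: "orthonormal_on UNIV d"
  obtains y where "y \<in> orth_span UNIV d" "\<And>k. y \<bullet> d k = x \<bullet> e k"
    "(\<lambda>k. (x \<bullet> e k)\<^sup>2) sums (norm y)\<^sup>2"
proof -
  let ?S = "\<lambda>N. \<Sum>k<N. (x \<bullet> e k) *\<^sub>R d k"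
  let ?Q = "\<lambda>N. \<Sum>k<N. (x \<bullet> e k)\<^sup>2"
  have diff: "(norm (?S N - ?S M))\<^sup>2 = ?Q N - ?Q M" if "M \<le> N" for M N
  proof -
    have "?S N - ?S M = (\<Sum>k\<in>{M..<N}. (x \<bullet> e k) *\<^sub>R d k)"
      using that by (simp add: lessThan_atLeast0 sum_diff_nat_ivl)
    moreover have "?Q N - ?Q M = (\<Sum>k\<in>{M..<N}. (x \<bullet> e k)\<^sup>2)"
      using that by (simp add: lessThan_atLeast0 sum_diff_nat_ivl)
    ultimately show ?thesis
      using norm_sum_orthonormal[OF d, of "{M..<N}" "\<lambda>k. x \<bullet> e k"] by simp
  qed
  have "summable (\<lambda>k. (x \<bullet> e k)\<^sup>2)"
    by (rule summableI_nonneg_bounded[where x = "(norm x)\<^sup>2"])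
       (auto intro: Bessel_finite[OF e])
  then have "Cauchy ?Q"
    by (simp add: summable_iff_convergent convergent_Cauchy)
  have "Cauchy ?S"
  proof (rule metric_CauchyI)
    fix r :: real assume "0 < r"
    then obtain M where M: "\<And>m n. m \<ge> M \<Longrightarrow> n \<ge> M \<Longrightarrow> dist (?Q m) (?Q n) < r\<^sup>2"
      using \<open>Cauchy ?Q\<close> unfolding Cauchy_def by (meson zero_less_power)
    have le: "dist (?S m) (?S n) < r" if "m \<ge> M" "n \<ge> M" "n \<le> m" for m n
    proof -
      have "(norm (?S m - ?S n))\<^sup>2 < r\<^sup>2"
        using M[of m n] diff[of n m] that by (simp add: dist_real_def)
      then show ?thesis using \<open>0 < r\<close> by (simp add: dist_norm power_less_imp_less_base)
    qed
    show "\<exists>M. \<forall>m\<ge>M. \<forall>n\<ge>M. dist (?S m) (?S n) < r"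
    proof (intro exI[of _ M] allI impI)
      fix m n assume "m \<ge> M" "n \<ge> M"
      then show "dist (?S m) (?S n) < r"
        using le[of m n] le[of n m] by (cases "n \<le> m") (simp_all add: dist_commute)
    qed
  qed
  then obtain y where y: "?S \<longlonglongrightarrow> y"
    using Cauchy_convergent_iff convergent_def by blast
  show ?thesis
  proof
    show "y \<in> orth_span UNIV d"
      by (rule closed_sequentially[OF closed_orth_span _ y]) (auto intro: orth_span_sum)
    fix k
    have "(\<lambda>N. ?S N \<bullet> d k) \<longlonglongrightarrow> y \<bullet> d k" by (intro tendsto_intros y)
    \<comment> \<open>The \<open>k\<close>-th coefficient of the partial sum no longer changes once
      \<open>N\<close> exceeds \<open>k\<close>.\<close>
    moreover have "eventually (\<lambda>N. ?S N \<bullet> d k = x \<bullet> e k) sequentially"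
      using eventually_gt_at_top[of k]
    proof eventually_elim
      case (elim N)
      then show ?case
        using inner_sum_orthonormal_single[OF d, of "{..<N}" k "\<lambda>k. x \<bullet> e k"] by simp
    qed
    then have "(\<lambda>N. ?S N \<bullet> d k) \<longlonglongrightarrow> x \<bullet> e k" by (rule tendsto_eventually)
    ultimately show "y \<bullet> d k = x \<bullet> e k" by (rule LIMSEQ_unique)
  next
    have "(\<lambda>N. (norm (?S N))\<^sup>2) \<longlonglongrightarrow> (norm y)\<^sup>2" by (intro tendsto_intros y)
    moreover have "(norm (?S N))\<^sup>2 = ?Q N" for N by (simp add: norm_sum_orthonormal[OF d])
    ultimately show "(\<lambda>k. (x \<bullet> e k)\<^sup>2) sums (norm y)\<^sup>2" by (simp add: sums_def)
  qed
qed

text \<open>Zorn's lemma yields a maximal orthonormal set. If it were finite, a vector outside its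
  span would extend it by one Gram-Schmidt step.\<close>

lemma infinite_orthonormal_exists:
  assumes "\<not> (\<exists>B. finite B \<and> span B = (UNIV :: 'h::real_inner set))"
  shows "\<exists>e :: nat \<Rightarrow> 'h. orthonormal_on UNIV e"
proof -
  define P :: "'h set \<Rightarrow> bool" where "P B \<longleftrightarrow> orthonormal_on B id" for B
  have "\<exists>M\<in>Collect P. \<forall>Y\<in>Collect P. M \<subseteq> Y \<longrightarrow> Y = M"
  proof (rule subset_Zorn')
    fix C assume "subset.chain (Collect P) C"
    then have C: "C \<subseteq> Collect P" "\<And>A B. A \<in> C \<Longrightarrow> B \<in> C \<Longrightarrow> A \<subseteq> B \<or> B \<subseteq> A"
      by (auto simp: subset_chain_def)
    have "x \<bullet> y = (if x = y then 1 else 0)" if "x \<in> \<Union>C" "y \<in> \<Union>C" for x y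
    proof -
      from that obtain A B where "A \<in> C" "B \<in> C" "x \<in> A" "y \<in> B" by auto
      with C obtain D where "D \<in> C" "x \<in> D" "y \<in> D" by blast
      with C(1) show ?thesis by (auto simp: P_def orthonormal_on_def)
    qed
    then show "\<Union>C \<in> Collect P" by (simp add: P_def orthonormal_on_def)
  qed
  then obtain M where M: "P M" "\<And>Y. P Y \<Longrightarrow> M \<subseteq> Y \<Longrightarrow> Y = M" by auto
  have "infinite M"
  proof
    assume fin: "finite M"
    with assms obtain a where a: "a \<notin> span M" by blast
    let ?s = "\<Sum>k\<in>M. (a \<bullet> id k) *\<^sub>R id k"
    have s: "?s \<in> span M" by (intro span_sum span_scale) (auto intro: span_base)
    define v where "v = (a - ?s) /\<^sub>R norm (a - ?s)"
    have "a - ?s \<noteq> 0" using a s by auto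
    then have v1: "v \<bullet> v = 1"
      unfolding v_def by (simp flip: power2_norm_eq_inner)
    have vM: "v \<bullet> m = 0" if "m \<in> M" for m
    proof -
      have "?s \<bullet> id m = a \<bullet> m"
        using that fin M(1) by (subst inner_sum_orthonormal_single[of M]) (auto simp: P_def)
      then show ?thesis by (simp add: v_def inner_diff_left)
    qed
    have "P (insert v M)"
      using M(1) v1 vM unfolding P_def orthonormal_on_def by (auto simp: inner_commute)
    then have "v \<in> M" using M(2)[of "insert v M"] by auto
    then show False using v1 vM by fastforce
  qed
  then obtain e :: "nat \<Rightarrow> 'h" where "inj e" "range e \<subseteq> M"
    using infinite_countable_subset by blast
  then have "orthonormal_on UNIV (id \<circ> e)"
    using M(1) by (intro orthonormal_on_comp[of M]) (auto simp: P_def)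
  then show ?thesis by auto
qed

text \<open>The permutation operator on the closed span of \<open>b\<close> that sends \<open>b m\<close> to \<open>b (f m)\<close>.\<close>
definition perm_op :: "'x set \<Rightarrow> ('x \<Rightarrow> 'h::real_inner) \<Rightarrow> ('x \<Rightarrow> 'x) \<Rightarrow> 'h \<Rightarrow> 'h" where
  "perm_op X b f x = (THE y. y \<in> orth_span X b \<and> (\<forall>m\<in>X. y \<bullet> b (f m) = x \<bullet> b m))"

lemma orth_span_reindex:
  assumes "bij_betw h A X"
  shows "orth_span A (b \<circ> h) = orth_span X b"
  using bij_betw_imp_surj_on[OF assms] by (force simp: orth_span_def)

section \<open>Permutation operators on a closed span\<close>

context
  fixes X :: "'x set" and b :: "'x \<Rightarrow> 'h::{real_inner, complete_space}"
  assumes X: "countable X" "infinite X" and b: "orthonormal_on X b"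
begin

lemma perm_op_exists:
  assumes f: "bij_betw f X X" and x: "x \<in> orth_span X b"
  shows "\<exists>y\<in>orth_span X b. (\<forall>m\<in>X. y \<bullet> b (f m) = x \<bullet> b m) \<and> norm y = norm x"
proof -
  let ?h = "from_nat_into X"
  have h: "bij_betw ?h UNIV X" by (rule bij_betw_from_nat_into[OF X])
  have fh: "bij_betw (f \<circ> ?h) UNIV X" by (rule bij_betw_trans[OF h f])
  have e: "orthonormal_on UNIV (b \<circ> ?h)"
    using h by (intro orthonormal_on_comp[OF b]) (auto simp: bij_betw_def)
  have d: "orthonormal_on UNIV (b \<circ> (f \<circ> ?h))"
    using fh by (intro orthonormal_on_comp[OF b]) (auto simp: bij_betw_def)
  obtain y where y: "y \<in> orth_span UNIV (b \<circ> (f \<circ> ?h))"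
    "\<And>k. y \<bullet> (b \<circ> (f \<circ> ?h)) k = x \<bullet> (b \<circ> ?h) k"
    "(\<lambda>k. (x \<bullet> (b \<circ> ?h) k)\<^sup>2) sums (norm y)\<^sup>2"
    using orthonormal_series[OF e d] by metis
  \<comment> \<open>Taking both families equal rebuilds \<open>x\<close> from its own coefficients.
    This gives Parseval's identity for \<open>x\<close>, and comparison of the two series yields
    equality of norms.\<close>
  obtain z where z: "z \<in> orth_span UNIV (b \<circ> ?h)"
    "\<And>k. z \<bullet> (b \<circ> ?h) k = x \<bullet> (b \<circ> ?h) k"
    "(\<lambda>k. (x \<bullet> (b \<circ> ?h) k)\<^sup>2) sums (norm z)\<^sup>2"
    using orthonormal_series[OF e e] by metis
  have "z = x"
    using z x by (intro orth_span_eqI[of z UNIV "b \<circ> ?h"]) (auto simp: orth_span_reindex[OF h])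
  then have "norm y = norm x"
    using sums_unique2[OF y(3) z(3)] by simp
  moreover have "y \<bullet> b (f m) = x \<bullet> b m" if "m \<in> X" for m
    using y(2)[of "to_nat_on X m"] that X by simp
  ultimately show ?thesis
    using y(1) by (auto simp: orth_span_reindex[OF fh])
qed

text \<open>As \<open>f\<close> is onto, the prescribed coefficients cover all of \<open>X\<close>
  and determine the vector. Linearity, surjectivity and the homomorphism property of the operators
  all follow from this uniqueness.\<close>

lemma perm_op_eqI:
  assumes f: "bij_betw f X X" and "y \<in> orth_span X b"
    and "\<And>m. m \<in> X \<Longrightarrow> y \<bullet> b (f m) = x \<bullet> b m"
  shows "perm_op X b f x = y"
  unfolding perm_op_def
proof (rule the_equality)
  show "y \<in> orth_span X b \<and> (\<forall>m\<in>X. y \<bullet> b (f m) = x \<bullet> b m)" using assms by auto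
  fix z assume z: "z \<in> orth_span X b \<and> (\<forall>m\<in>X. z \<bullet> b (f m) = x \<bullet> b m)"
  show "z = y"
  proof (rule orth_span_eqI[of _ X b])
    fix k assume "k \<in> X"
    then obtain m where "m \<in> X" "k = f m" using f by (metis bij_betw_imp_surj_on imageE)
    then show "z \<bullet> b k = y \<bullet> b k" using z assms(3) by simp
  qed (use z assms in auto)
qed

lemma
  assumes f: "bij_betw f X X" and x: "x \<in> orth_span X b"
  shows perm_op_in: "perm_op X b f x \<in> orth_span X b"
    and perm_op_inner: "m \<in> X \<Longrightarrow> perm_op X b f x \<bullet> b (f m) = x \<bullet> b m"
    and norm_perm_op: "norm (perm_op X b f x) = norm x"
proof -
  obtain y where y: "y \<in> orth_span X b" "\<And>m. m \<in> X \<Longrightarrow> y \<bullet> b (f m) = x \<bullet> b m"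
    "norm y = norm x"
    using perm_op_exists[OF assms] by blast
  have "perm_op X b f x = y" by (rule perm_op_eqI[OF f y(1,2)])
  with y show "perm_op X b f x \<in> orth_span X b"
    "m \<in> X \<Longrightarrow> perm_op X b f x \<bullet> b (f m) = x \<bullet> b m" "norm (perm_op X b f x) = norm x"
    by auto
qed

lemma perm_op_add:
  assumes f: "bij_betw f X X" and "x \<in> orth_span X b" "y \<in> orth_span X b"
  shows "perm_op X b f (x + y) = perm_op X b f x + perm_op X b f y"
  using assms
  by (intro perm_op_eqI subspace_add[OF subspace_orth_span] perm_op_in f)
     (auto simp: inner_add_left perm_op_inner)

lemma perm_op_scale:
  assumes f: "bij_betw f X X" and "x \<in> orth_span X b"
  shows "perm_op X b f (a *\<^sub>R x) = a *\<^sub>R perm_op X b f x"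
  using assms
  by (intro perm_op_eqI subspace_scale[OF subspace_orth_span] perm_op_in f)
     (auto simp: perm_op_inner)

lemma perm_op_surj:
  assumes f: "bij_betw f X X"
  shows "perm_op X b f ` orth_span X b = orth_span X b"
proof (intro equalityI subsetI)
  fix y assume y: "y \<in> orth_span X b"
  let ?g = "inv_into X f"
  have g: "bij_betw ?g X X" by (rule bij_betw_inv_into[OF f])
  have "perm_op X b f (perm_op X b ?g y) = y"
  proof (rule perm_op_eqI[OF f y])
    fix m assume m: "m \<in> X"
    then have "f m \<in> X" using f bij_betwE by blast
    then have "perm_op X b ?g y \<bullet> b (?g (f m)) = y \<bullet> b (f m)" by (rule perm_op_inner[OF g y])
    moreover have "?g (f m) = m" using f m by (rule bij_betw_inv_into_left)
    ultimately show "y \<bullet> b (f m) = perm_op X b ?g y \<bullet> b m" by simp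
  qed
  then show "y \<in> perm_op X b f ` orth_span X b" using perm_op_in[OF g y] by force
qed (use perm_op_in[OF f] in auto)

lemma perm_op_inner_self:
  fixes c :: real
  assumes f: "bij_betw f X X" and F: "finite F" "F \<subseteq> X"
  defines "\<xi> \<equiv> \<Sum>k\<in>F. c *\<^sub>R b k"
  shows "perm_op X b f \<xi> \<bullet> \<xi> = c\<^sup>2 * card {x \<in> F. f x \<in> F}"
proof -
  have fF: "finite (f ` F)" "f ` F \<subseteq> X" using f F by (auto simp: bij_betw_def)
  have injF: "inj_on f F" using f F by (auto simp: bij_betw_def intro: inj_on_subset)
  have "perm_op X b f \<xi> = (\<Sum>k\<in>f ` F. c *\<^sub>R b k)"
  proof (rule perm_op_eqI[OF f])
    show "(\<Sum>k\<in>f ` F. c *\<^sub>R b k) \<in> orth_span X b" by (rule orth_span_sum[OF fF(2)])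
    fix m assume m: "m \<in> X"
    then have "f m \<in> X" using f bij_betwE by blast
    moreover have "f m \<in> f ` F \<longleftrightarrow> m \<in> F"
      using f F m by (auto simp: bij_betw_def inj_on_eq_iff subset_iff)
    ultimately show "(\<Sum>k\<in>f ` F. c *\<^sub>R b k) \<bullet> b (f m) = \<xi> \<bullet> b m"
      unfolding \<xi>_def
      using inner_sum_orthonormal_single[OF b fF, of "f m" "\<lambda>_. c"]
        inner_sum_orthonormal_single[OF b F m, of "\<lambda>_. c"] by simp
  qed
  also have "\<dots> = (\<Sum>k\<in>F. c *\<^sub>R b (f k))" using injF by (simp add: sum.reindex)
  finally have "perm_op X b f \<xi> \<bullet> \<xi> = (\<Sum>k\<in>F. c * (\<xi> \<bullet> b (f k)))"
    by (simp only: inner_sum_left inner_scaleR_left inner_commute[of "b _" \<xi>])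
  also have "\<dots> = (\<Sum>k\<in>F. if f k \<in> F then c\<^sup>2 else 0)"
  proof (rule sum.cong[OF refl])
    fix k assume "k \<in> F"
    then have "f k \<in> X" using fF by blast
    then have "\<xi> \<bullet> b (f k) = (if f k \<in> F then c else 0)"
      unfolding \<xi>_def by (rule inner_sum_orthonormal_single[OF b F])
    then show "c * (\<xi> \<bullet> b (f k)) = (if f k \<in> F then c\<^sup>2 else 0)"
      by (simp add: power2_eq_square)
  qed
  also have "\<dots> = (\<Sum>k\<in>{x \<in> F. f x \<in> F}. c\<^sup>2)"
    by (rule sum.inter_filter[OF F(1), symmetric])
  also have "\<dots> = c\<^sup>2 * card {x \<in> F. f x \<in> F}" by simp
  finally show ?thesis .
qed

end

text \<open>Normalised indicators of Folner sets are almost invariant. The coefficients of an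
  invariant vector are constant on orbits; the orbits are infinite, so square-summability makes the
  vector zero. The hypothesis on orbits is phrased through nonempty invariant sets.\<close>

lemma not_has_T_if_amenable_action:
  fixes G :: "('g, 'b) monoid_scheme" and X :: "'x set" and act :: "'g \<Rightarrow> 'x \<Rightarrow> 'x"
  assumes inf: "\<not> (\<exists>B. finite B \<and> span B = (UNIV :: 'h::{real_inner, complete_space} set))"
    and X: "countable X" "infinite X"
    and bij: "\<And>g. g \<in> carrier G \<Longrightarrow> bij_betw (act g) X X"
    and one: "\<And>x. x \<in> X \<Longrightarrow> act \<one>\<^bsub>G\<^esub> x = x" "\<one>\<^bsub>G\<^esub> \<in> carrier G"
    and closed: "\<And>g h. g \<in> carrier G \<Longrightarrow> h \<in> carrier G \<Longrightarrow> g \<otimes>\<^bsub>G\<^esub> h \<in> carrier G"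
    and mult: "\<And>g h x. g \<in> carrier G \<Longrightarrow> h \<in> carrier G \<Longrightarrow> x \<in> X \<Longrightarrow>
      act (g \<otimes>\<^bsub>G\<^esub> h) x = act g (act h x)"
    and Folner: "\<And>Q \<delta>. Q \<subseteq> carrier G \<Longrightarrow> finite Q \<Longrightarrow> 0 < (\<delta>::real) \<Longrightarrow>
      \<exists>F \<subseteq> X. finite F \<and> F \<noteq> {} \<and> (\<forall>g\<in>Q. real (card {x \<in> F. act g x \<notin> F}) < \<delta> * card F)"
    and orbits: "\<And>Y. Y \<subseteq> X \<Longrightarrow> Y \<noteq> {} \<Longrightarrow> (\<And>g y. g \<in> carrier G \<Longrightarrow> y \<in> Y \<Longrightarrow> act g y \<in> Y) \<Longrightarrow>
      infinite Y"
  shows "\<not> has_T TYPE('h) G"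
proof -
  obtain e :: "nat \<Rightarrow> 'h" where e: "orthonormal_on UNIV e"
    using infinite_orthonormal_exists[OF inf] by blast
  \<comment> \<open>Countability of \<open>X\<close> lets an orthonormal sequence be indexed by
    \<open>X\<close>.\<close>
  define b where "b = e \<circ> to_nat_on X"
  have b: "orthonormal_on X b"
    unfolding b_def using X by (intro orthonormal_on_comp[OF e]) auto
  let ?H = "orth_span X b" and ?U = "\<lambda>g. perm_op X b (act g)"
  note ops = perm_op_in[OF X b] perm_op_inner[OF X b] perm_op_eqI[OF X b]
  have rep: "orth_rep G ?H ?U"
    unfolding orth_rep_def
  proof (intro conjI ballI allI)
    fix g h x assume g: "g \<in> carrier G" and h: "h \<in> carrier G" and x: "x \<in> ?H"
    have hx: "?U h x \<in> ?H" by (rule ops(1)[OF bij[OF h] x])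
    show "?U (g \<otimes>\<^bsub>G\<^esub> h) x = ?U g (?U h x)"
    proof (rule ops(3)[OF bij[OF closed[OF g h]] ops(1)[OF bij[OF g] hx]])
      fix m assume m: "m \<in> X"
      then have "act h m \<in> X" using bij_betwE[OF bij[OF h]] by blast
      then show "?U g (?U h x) \<bullet> b (act (g \<otimes>\<^bsub>G\<^esub> h) m) = x \<bullet> b m"
        by (simp add: mult[OF g h m] ops(2)[OF bij[OF g] hx] ops(2)[OF bij[OF h] x m])
    qed
  qed (use bij one in \<open>auto simp: perm_op_surj[OF X b] perm_op_add[OF X b] perm_op_scale[OF X b]
         norm_perm_op[OF X b] intro!: ops(3)\<close>)
  have alm: "almost_invariant_vectors G ?H ?U"
    unfolding almost_invariant_vectors_def
  proof (intro allI impI)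
    fix Q and \<epsilon> :: real assume Q: "Q \<subseteq> carrier G" "finite Q" and \<epsilon>: "0 < \<epsilon>"
    \<comment> \<open>The squared displacement of the unit vector below is twice the proportion of
      \<open>F\<close> that leaves \<open>F\<close>; hence this bound.\<close>
    from Folner[OF Q, of "\<epsilon>\<^sup>2 / 2"] \<epsilon> obtain F
      where F: "F \<subseteq> X" "finite F" "F \<noteq> {}"
        and small: "\<And>g. g \<in> Q \<Longrightarrow> real (card {x \<in> F. act g x \<notin> F}) < \<epsilon>\<^sup>2 / 2 * card F"
      by auto
    define c where "c = 1 / sqrt (card F)"
    have cF: "card F > 0" using F by (simp add: card_gt_0_iff)
    have c2: "c\<^sup>2 = 1 / card F" by (simp add: c_def power_divide)
    define \<xi> where "\<xi> = (\<Sum>k\<in>F. c *\<^sub>R b k)"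
    have \<xi>: "\<xi> \<in> ?H" unfolding \<xi>_def by (rule orth_span_sum[OF F(1)])
    have "(norm \<xi>)\<^sup>2 = 1"
      unfolding \<xi>_def using cF by (subst norm_sum_orthonormal[OF b F(2,1)]) (simp add: c2)
    then have n1: "norm \<xi> = 1"
      using norm_ge_zero[of \<xi>] unfolding power2_eq_1_iff by linarith
    have "norm (?U g \<xi> - \<xi>) < \<epsilon>" if g: "g \<in> Q" for g
    proof -
      have g': "bij_betw (act g) X X" using g Q bij by blast
      have "card F = card {x \<in> F. act g x \<in> F} + card {x \<in> F. act g x \<notin> F}"
        using F(2) by (subst card_Un_disjoint[symmetric]) (auto intro: arg_cong[where f = card])
      then have cards: "real (card {x \<in> F. act g x \<in> F}) =
          real (card F) - real (card {x \<in> F. act g x \<notin> F})" by simp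
      have "(norm (?U g \<xi> - \<xi>))\<^sup>2 = (norm (?U g \<xi>))\<^sup>2 + (norm \<xi>)\<^sup>2 - 2 * (?U g \<xi> \<bullet> \<xi>)"
        by (simp add: power2_norm_eq_inner inner_diff_left inner_diff_right inner_commute)
      also have "\<dots> = 2 - 2 * (?U g \<xi> \<bullet> \<xi>)"
        using n1 norm_perm_op[OF X b g' \<xi>] by simp
      also have "\<dots> = 2 * real (card {x \<in> F. act g x \<notin> F}) / card F"
        unfolding \<xi>_def using cF
        by (subst perm_op_inner_self[OF X b g' F(2,1)]) (simp add: c2 cards field_simps)
      also have "\<dots> < \<epsilon>\<^sup>2" using small[OF g] cF by (simp add: field_simps)
      finally show ?thesis using \<epsilon> by (simp add: power_less_imp_less_base)
    qed
    then show "\<exists>\<xi>\<in>?H. norm \<xi> = 1 \<and> (\<forall>g\<in>Q. norm (?U g \<xi> - \<xi>) < \<epsilon>)"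
      using \<xi> n1 by blast
  qed
  have noinv: "\<xi> = 0" if \<xi>: "\<xi> \<in> ?H" and invariant: "\<forall>g\<in>carrier G. ?U g \<xi> = \<xi>" for \<xi>
  proof (rule orth_span_eqI[OF \<xi> subspace_0[OF subspace_orth_span]])
    fix k assume k: "k \<in> X"
    let ?c = "\<xi> \<bullet> b k"
    \<comment> \<open>A level set of the coefficients of the invariant vector: it is invariant under
      the group, hence infinite. If the level were nonzero, sufficiently many of its points would
      violate Bessel's inequality.\<close>
    define Y where "Y = {y \<in> X. \<xi> \<bullet> b y = ?c}"
    have "infinite Y"
    proof (rule orbits)
      fix g y assume g: "g \<in> carrier G" and y: "y \<in> Y"
      have "\<xi> \<bullet> b (act g y) = \<xi> \<bullet> b y"
        using ops(2)[OF bij[OF g] \<xi>, of y] invariant g y by (simp add: Y_def)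
      then show "act g y \<in> Y" using y bij_betwE[OF bij[OF g]] by (auto simp: Y_def)
    qed (use k in \<open>auto simp: Y_def\<close>)
    show "?c = 0 \<bullet> b k"
    proof (rule ccontr)
      assume "?c \<noteq> 0 \<bullet> b k"
      then have c: "?c\<^sup>2 > 0" by simp
      then obtain N :: nat where N: "(norm \<xi>)\<^sup>2 < N * ?c\<^sup>2"
        using reals_Archimedean3 by blast
      obtain F where F: "F \<subseteq> Y" "finite F" "card F = N"
        using infinite_arbitrarily_large[OF \<open>infinite Y\<close>] by blast
      have "(\<Sum>k\<in>F. (\<xi> \<bullet> b k)\<^sup>2) \<le> (norm \<xi>)\<^sup>2"
        using F by (intro Bessel_finite[OF b]) (auto simp: Y_def)
      moreover have "(\<Sum>k\<in>F. (\<xi> \<bullet> b k)\<^sup>2) = (\<Sum>k\<in>F. ?c\<^sup>2)"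
        using F by (intro sum.cong) (auto simp: Y_def)
      ultimately show False using F N by simp
    qed
  qed
  show ?thesis
    unfolding has_T_def
    using rep alm noinv subspace_orth_span[of X b] closed_orth_span[of X b] by blast
qed

section \<open>Failure of FA and (T)\<close>

lemma Spe_group_simps [simp]:
  "carrier (Spe_group n) = Spe_set n"
  "mult (Spe_group n) = mult (Aut_group n)"
  "one (Spe_group n) = one (Aut_group n)"
  by (simp_all add: Spe_group_def)

lemma not_FA_Spe:
  assumes n: "n \<ge> 2" and inf: "infinite (UNIV :: 'v set)"
  shows "\<not> has_FA TYPE('v) (Spe_group n)"
proof -
  obtain h :: "nat \<Rightarrow> 'v" where "inj h" using inf infinite_countable_subset by blast
  moreover obtain c :: "int \<Rightarrow> nat" where "inj c" by (meson inj_to_nat)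
  ultimately have inj: "inj (h \<circ> c)" by (rule inj_compose)
  define \<iota> where "\<iota> = h \<circ> c"
  have \<iota>: "inj \<iota>" using inj by (simp add: \<iota>_def)
  have ij: "0 < n" "1 < n" "(0::nat) \<noteq> 1" using n by auto
  define F where "F \<phi> = line_map n \<phi> 0 1" for \<phi>
  define act where "act \<phi> v = \<iota> (F \<phi> (inv_into UNIV \<iota> v))" for \<phi> v
  have act [simp]: "act \<phi> (\<iota> m) = \<iota> (F \<phi> m)" for \<phi> m using \<iota> by (simp add: act_def)
  \<comment> \<open>The number \<open>a\<close> is the image of the vertex 0, the centre of
    \<open>\<phi> [0]\<close>, and so is even.\<close>
  have iso: "\<exists>s. (s = 1 \<or> s = -1) \<and> (\<exists>a. even a \<and> (\<forall>m. F \<phi> m = a + s * m))" if "\<phi> \<in> Spe_set n" for \<phi>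
  proof -
    have \<phi>: "\<phi> \<in> auto (W n)" using that Spe_subset by blast
    show ?thesis
      using line_map_isometry[OF \<phi> ij] centre_reflection(1)[OF \<phi> ij] unfolding F_def by metis
  qed
  \<comment> \<open>Special automorphisms fix the indices 0 and 1, so composition stays on this one
    line.\<close>
  have F_mult: "F (\<phi> \<otimes>\<^bsub>Aut_group n\<^esub> \<psi>) m = F \<phi> (F \<psi> m)"
    if "\<phi> \<in> Spe_set n" "\<psi> \<in> Spe_set n" for \<phi> \<psi> m
    using line_map_mult[OF _ _ ij, of \<phi> \<psi> m] that Spe_subset[of n] gen_perm_Spe[OF that(2)] ij
    by (auto simp: F_def)
  have "tree_action (Spe_group n) (range \<iota>) (line_edges \<iota>) act"
    unfolding tree_action_def
  proof (intro conjI ballI)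
    fix \<phi> assume "\<phi> \<in> carrier (Spe_group n)"
    then obtain s a where sa: "s = 1 \<or> s = -1" "\<And>m. F \<phi> m = a + s * m"
      using iso[of \<phi>] by auto
    show "bij_betw (act \<phi>) (range \<iota>) (range \<iota>)"
      \<comment> \<open>The sign \<open>s\<close> is its own inverse, so this inverts
        \<open>a + s * m\<close>.\<close>
      by (rule bij_betw_byWitness[where f' = "\<lambda>v. \<iota> (s * (inv_into UNIV \<iota> v - a))"])
        (use sa(1) in \<open>auto simp: \<iota> sa(2)\<close>)
    fix u v assume "u \<in> range \<iota>" "v \<in> range \<iota>"
    then obtain m m' where uv: "u = \<iota> m" "v = \<iota> m'" by auto
    have "\<bar>F \<phi> m - F \<phi> m'\<bar> = \<bar>m - m'\<bar>" using sa(1) by (auto simp: sa(2))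
    then show "((act \<phi> u, act \<phi> v) \<in> line_edges \<iota>) = ((u, v) \<in> line_edges \<iota>)"
      by (simp add: uv line_edges_iff[OF \<iota>])
  next
    fix v assume "v \<in> range \<iota>"
    then show "act \<one>\<^bsub>Spe_group n\<^esub> v = v"
      using line_map_one[OF ij] by (auto simp: F_def)
  next
    fix \<phi> \<psi> v
    assume "\<phi> \<in> carrier (Spe_group n)" "\<psi> \<in> carrier (Spe_group n)" "v \<in> range \<iota>"
    then show "act (\<phi> \<otimes>\<^bsub>Spe_group n\<^esub> \<psi>) v = act \<phi> (act \<psi> v)"
      by (auto simp: F_mult)
  qed
  moreover have "without_inversions (Spe_group n) (line_edges \<iota>) act"
    unfolding without_inversions_def
  proof (clarsimp simp: line_edges_def)
    fix \<phi> m m' assume \<phi>: "\<phi> \<in> Spe_set n" and mm: "\<bar>m - m'\<bar> = 1"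
      and eq: "\<iota> (F \<phi> m) = \<iota> m'" "\<iota> (F \<phi> m') = \<iota> m"
    obtain s a where s: "s = 1 \<or> s = -1" and a: "even a" "\<And>m. F \<phi> m = a + s * m"
      using iso[OF \<phi>] by auto
    have m': "m' = a + s * m" using eq(1) \<iota> a(2) by (simp add: inj_eq)
    \<comment> \<open>Vertices keep their parity, whereas the two ends of an edge have opposite
      parities.\<close>
    have "even (m' - m)" using s a(1) unfolding m' by auto
    moreover have "m' = m + 1 \<or> m' = m - 1" using mm by linarith
    ultimately show False by auto
  qed
  moreover have "\<not> (\<exists>v\<in>range \<iota>. \<forall>\<phi>\<in>carrier (Spe_group n). act \<phi> v = v)"
  proof
    assume "\<exists>v\<in>range \<iota>. \<forall>\<phi>\<in>carrier (Spe_group n). act \<phi> v = v"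
    then obtain m where m: "\<And>\<phi>. \<phi> \<in> Spe_set n \<Longrightarrow> F \<phi> m = m"
      using \<iota> by (auto simp: inj_eq)
    have "- m = m" "2 - m = m"
      using m[OF inner_aut_in_Spe, of "[0]"] m[OF inner_aut_in_Spe, of "[1]"] ij
        line_map_inner_left[OF ij] line_map_inner_right[OF ij] by (simp_all add: F_def)
    then show False by simp
  qed
  ultimately show ?thesis
    unfolding has_FA_def using line_tree[OF \<iota>] by blast
qed

text \<open>Take the same long interval on every line. An isometry moving 0 by at most
  \<open>K\<close> can push out only points within \<open>K\<close> of an end, a number independent
  of the length of the interval.\<close>

lemma lines_Folner:
  assumes n: "n \<ge> 2" and Q: "Q \<subseteq> auto (W n)" "finite Q" and \<delta>: "0 < (\<delta>::real)"
  shows "\<exists>F \<subseteq> pairs n \<times> UNIV. finite F \<and> F \<noteq> {} \<and>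
    (\<forall>\<phi>\<in>Q. real (card {x \<in> F. lines_act n \<phi> x \<notin> F}) < \<delta> * card F)"
proof -
  \<comment> \<open>A finite sum of nonnegative terms bounds each of them, so \<open>K\<close> works
    for all of \<open>Q\<close> and all lines at once.\<close>
  define K where "K = (\<Sum>(\<phi>, i, j)\<in>Q \<times> pairs n. nat \<bar>centre n \<phi> i j i\<bar>)"
  have K: "\<bar>centre n \<phi> i j i\<bar> \<le> int K" if "\<phi> \<in> Q" "(i, j) \<in> pairs n" for \<phi> i j
  proof -
    have "(case (\<phi>, i, j) of (\<phi>, i, j) \<Rightarrow> nat \<bar>centre n \<phi> i j i\<bar>) \<le> K"
      unfolding K_def using that Q(2) finite_pairs by (intro member_le_sum) auto
    then show ?thesis by simp
  qed
  obtain M :: nat where M: "real K < M * \<delta>" using reals_Archimedean3[OF \<delta>] by blast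
  \<comment> \<open>The summand \<open>M\<close> makes the interval long relative to
    \<open>K\<close>; the summand \<open>K\<close> makes \<open>N - K\<close> a genuine difference
    of natural numbers.\<close>
  define N where "N = K + M"
  have N: "2 * real K < \<delta> * (2 * N + 1)"
  proof -
    have "2 * real K < \<delta> * (2 * M)" using M by (simp add: mult.commute)
    also have "\<dots> \<le> \<delta> * (2 * N + 1)" using \<delta> by (intro mult_left_mono) (auto simp: N_def)
    finally show ?thesis .
  qed
  define F where "F = pairs n \<times> {- int N..int N}"
  have "(0, 1) \<in> pairs n" using n by (auto simp: pairs_def)
  then have ne: "pairs n \<noteq> {}" by auto
  then have cp: "card (pairs n) > 0" by (simp add: card_gt_0_iff finite_pairs)
  have cardF: "card F = card (pairs n) * (2 * N + 1)"
    by (simp add: F_def card_cartesian_product nat_add_distrib nat_mult_distrib)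
  have "real (card {x \<in> F. lines_act n \<phi> x \<notin> F}) < \<delta> * card F" if \<phi>: "\<phi> \<in> Q" for \<phi>
  proof -
    have aut: "\<phi> \<in> auto (W n)" using \<phi> Q by blast
    \<comment> \<open>The two end segments, with \<open>2 * K\<close> points in total. A point of
      the inner interval is sent to absolute value at most \<open>K + (N - K) = N\<close>.\<close>
    let ?B = "{- int N..int N} - {- int (N - K)..int (N - K)}"
    have "{x \<in> F. lines_act n \<phi> x \<notin> F} \<subseteq> pairs n \<times> ?B"
    proof
      fix x assume x: "x \<in> {x \<in> F. lines_act n \<phi> x \<notin> F}"
      then obtain i j m where ijm: "x = ((i, j), m)" "(i, j) \<in> pairs n" "m \<in> {- int N..int N}"
        by (auto simp: F_def)
      have ij: "i < n" "j < n" "i \<noteq> j" using ijm by (auto simp: pairs_def)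
      obtain s where s: "s = 1 \<or> s = -1" "line_map n \<phi> i j m = centre n \<phi> i j i + s * m"
        using line_map_isometry[OF aut ij] by metis
      have "lines_act n \<phi> x \<in> pairs n \<times> UNIV" using lines_act_in[OF aut] ijm by auto
      then have "line_map n \<phi> i j m \<notin> {- int N..int N}"
        using x ijm(1) by (auto simp: F_def lines_act_def)
      then have "m \<notin> {- int (N - K)..int (N - K)}"
        using s K[OF \<phi> ijm(2)] by (auto simp: N_def)
      then show "x \<in> pairs n \<times> ?B" using ijm by auto
    qed
    then have "card {x \<in> F. lines_act n \<phi> x \<notin> F} \<le> card (pairs n \<times> ?B)"
      by (intro card_mono) (auto simp: finite_pairs)
    moreover have "card ?B = 2 * K"
      by (subst card_Diff_subset) (auto simp: N_def)
    ultimately have "card {x \<in> F. lines_act n \<phi> x \<notin> F} \<le> card (pairs n) * (2 * K)"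
      by (simp add: card_cartesian_product)
    then have "real (card {x \<in> F. lines_act n \<phi> x \<notin> F}) \<le> real (card (pairs n) * (2 * K))"
      by (rule of_nat_mono)
    then have "real (card {x \<in> F. lines_act n \<phi> x \<notin> F}) \<le> card (pairs n) * (2 * real K)"
      by simp
    also have "\<dots> < card (pairs n) * (\<delta> * (2 * N + 1))" using N cp by simp
    also have "\<dots> = \<delta> * card F" by (simp add: cardF algebra_simps)
    finally show ?thesis .
  qed
  then show ?thesis
    using ne by (intro exI[of _ F]) (auto simp: F_def finite_pairs)
qed

text \<open>Treats Spe(W_n) and Aut(W_n) together: the Folner sets serve any finite set of
  automorphisms, while infinite orbits require only the inner automorphisms, which lie in
  Spe(W_n).\<close>

lemma not_T_between:
  assumes n: "n \<ge> 2"
    and inf: "\<not> (\<exists>B. finite B \<and> span B = (UNIV :: 'h::{real_inner, complete_space} set))"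
    and S: "S \<subseteq> auto (W n)" "Spe_set n \<subseteq> S"
    and closed: "\<And>\<phi> \<psi>. \<phi> \<in> S \<Longrightarrow> \<psi> \<in> S \<Longrightarrow> \<phi> \<otimes>\<^bsub>Aut_group n\<^esub> \<psi> \<in> S"
  shows "\<not> has_T TYPE('h) ((Aut_group n)\<lparr>carrier := S\<rparr>)"
proof (rule not_has_T_if_amenable_action[OF inf, where X = "pairs n \<times> UNIV" and act = "lines_act n"])
  let ?G = "(Aut_group n)\<lparr>carrier := S\<rparr>"
  have "(0, 1) \<in> pairs n" using n by (auto simp: pairs_def)
  then show "infinite (pairs n \<times> (UNIV :: int set))"
    by (auto simp: finite_cartesian_product_iff infinite_UNIV_int)
  show "countable (pairs n \<times> (UNIV :: int set))" by simp
  show "\<one>\<^bsub>?G\<^esub> \<in> carrier ?G" using S Spe_one by auto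
  show "bij_betw (lines_act n \<phi>) (pairs n \<times> UNIV) (pairs n \<times> UNIV)"
    if "\<phi> \<in> carrier ?G" for \<phi>
    using that S by (intro bij_lines_act) auto
  show "lines_act n \<one>\<^bsub>?G\<^esub> x = x" if "x \<in> pairs n \<times> UNIV" for x
    using lines_act_one[OF that] by simp
  show "\<phi> \<otimes>\<^bsub>?G\<^esub> \<psi> \<in> carrier ?G" if "\<phi> \<in> carrier ?G" "\<psi> \<in> carrier ?G" for \<phi> \<psi>
    using closed that by simp
  show "lines_act n (\<phi> \<otimes>\<^bsub>?G\<^esub> \<psi>) x = lines_act n \<phi> (lines_act n \<psi> x)"
    if "\<phi> \<in> carrier ?G" "\<psi> \<in> carrier ?G" "x \<in> pairs n \<times> UNIV" for \<phi> \<psi> x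
    using lines_act_mult[OF _ _ that(3)] that(1,2) S by auto
  show "\<exists>F \<subseteq> pairs n \<times> UNIV. finite F \<and> F \<noteq> {} \<and>
      (\<forall>\<phi>\<in>Q. real (card {x \<in> F. lines_act n \<phi> x \<notin> F}) < \<delta> * card F)"
    if "Q \<subseteq> carrier ?G" "finite Q" "0 < \<delta>" for Q and \<delta> :: real
    using that S by (intro lines_Folner[OF n]) auto
  show "infinite Y" if Y: "Y \<subseteq> pairs n \<times> UNIV" "Y \<noteq> {}"
      "\<And>\<phi> y. \<phi> \<in> carrier ?G \<Longrightarrow> y \<in> Y \<Longrightarrow> lines_act n \<phi> y \<in> Y" for Y :: "((nat \<times> nat) \<times> int) set"
  proof -
    obtain i j m where y: "((i, j), m) \<in> Y" using Y(2) by auto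
    then have ij: "i < n" "j < n" "i \<noteq> j" using Y(1) by (auto simp: pairs_def)
    \<comment> \<open>Reflecting in 0 and then in 1 sends \<open>m\<close> to \<open>- m\<close> and
      then to \<open>m + 2\<close>, on the same line because inner automorphisms fix the pair of
      indices.\<close>
    have shift: "((i, j), m + 2) \<in> Y" if "((i, j), m) \<in> Y" for m
    proof -
      have inner: "inner_aut n [k] \<in> Spe_set n" if "k < n" for k
        using that by (intro inner_aut_in_Spe) simp
      have "lines_act n (inner_aut n [j]) (lines_act n (inner_aut n [i]) ((i, j), m)) \<in> Y"
        using Y(3) inner S(2) ij that by (simp add: subset_iff)
      then show ?thesis
        using line_map_inner_left[OF ij] line_map_inner_right[OF ij] gen_perm_Spe[OF inner] ij
        by (simp add: lines_act_def add.commute)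
    qed
    have "((i, j), m + 2 * int k) \<in> Y" for k
    proof (induction k)
      case (Suc k)
      then show ?case using shift[of "m + 2 * int k"] by (simp add: algebra_simps)
    qed (use y in simp)
    then have "range (\<lambda>k. ((i, j), m + 2 * int k)) \<subseteq> Y" by blast
    moreover have "infinite (range (\<lambda>k. ((i, j), m + 2 * int k)))"
      by (rule range_inj_infinite) (auto simp: inj_on_def)
    ultimately show ?thesis using finite_subset by blast
  qed
qed

theorem theoremC:
  fixes n :: nat
  assumes "n \<ge> 2"
    and "infinite (UNIV :: 'v set)"
    and "\<not> (\<exists>B. finite B \<and> span B = (UNIV :: ('h::{real_inner, complete_space}) set))"
  shows "\<not> has_FA TYPE('v) (Spe_group n) \<and>
         \<not> has_T TYPE('h) (Spe_group n) \<and>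
         \<not> has_T TYPE('h) (Aut_group n)"
proof (intro conjI)
  show "\<not> has_FA TYPE('v) (Spe_group n)" by (rule not_FA_Spe[OF assms(1,2)])
  show "\<not> has_T TYPE('h) (Spe_group n)"
    unfolding Spe_group_def
    by (rule not_T_between[OF assms(1,3) Spe_subset order_refl Spe_mult])
  have "\<not> has_T TYPE('h) ((Aut_group n)\<lparr>carrier := auto (W n)\<rparr>)"
    by (rule not_T_between[OF assms(1,3) order_refl Spe_subset Aut_mult_closed])
  moreover have "(Aut_group n)\<lparr>carrier := auto (W n)\<rparr> = Aut_group n"
    by (simp add: Aut_group_def AutoGroup_def)
  ultimately show "\<not> has_T TYPE('h) (Aut_group n)" by simp
qed

end
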